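(* Let $\mathcal{N}\subseteq\mathcal{M}$ be an irreducible type II$_1$ subfactor of finite index (so $\mathcal{N}'\cap\mathcal{M}=\mathbb{C}\mathbf{1}$), and let $\Phi:\mathcal{M}\to\mathcal{M}$ be an $\mathcal{N}$-$\mathcal{N}$-bimodule quantum channel. Let $\mathcal{P}=\{x\in\mathcal{M}:\Phi(x)=x\}$ be the eigenspace of $\Phi$ for the eigenvalue $1$. Then $\mathcal{P}$ is an intermediate subfactor $\mathcal{N}\subseteq\mathcal{P}\subseteq\mathcal{M}$, and $\Phi$ is relatively irreducible as a $\mathcal{P}$-$\mathcal{P}$-bimodule quantum channel.
   Context: For a von Neumann subalgebra $\mathcal{Q}\subseteq\mathcal{M}$, a $\mathcal{Q}$-$\mathcal{Q}$-bimodule quantum channel on $\mathcal{M}$ is a normal, unital, completely positive linear map $\Phi:\mathcal{M}\to\mathcal{M}$ with $\Phi(y_1xy_2)=y_1\Phi(x)y_2$ for all $x\in\mathcal{M}$, $y_1,y_2\in\mathcal{Q}$. It is relatively irreducible (with respect to $\mathcal{Q}$) if whenever $p\in\mathcal{M}$ is a projection with $\Phi(p)\leq c\,p$ for some $c>0$, then $p\in\mathcal{Q}$. *)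

theory Defs
  imports "HOL-Analysis.Analysis"
begin

section \<open>Complex Hilbert spaces\<close>

text \<open>
  The norm, the topology and completeness are those of the underlying real inner product,
  which is the real part of the complex one; \<open>cinner\<close> is linear in its first argument.
\<close>

class chilbert_space = real_inner + complete_space +
  fixes scaleC :: "complex \<Rightarrow> 'a \<Rightarrow> 'a"  (infixr "*\<^sub>C" 75)
    and cinner :: "'a \<Rightarrow> 'a \<Rightarrow> complex"
  assumes scaleC_add_right: "a *\<^sub>C (x + y) = a *\<^sub>C x + a *\<^sub>C y"
    and scaleC_add_left: "(a + b) *\<^sub>C x = a *\<^sub>C x + b *\<^sub>C x"
    and scaleC_scaleC: "a *\<^sub>C (b *\<^sub>C x) = (a * b) *\<^sub>C x"
    and scaleC_of_real: "complex_of_real r *\<^sub>C x = r *\<^sub>R x"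
    and cinner_commute: "cinner x y = cnj (cinner y x)"
    and cinner_add_left: "cinner (x + y) z = cinner x z + cinner y z"
    and cinner_scaleC_left: "cinner (a *\<^sub>C x) y = a * cinner x y"
    and inner_eq_Re_cinner: "inner x y = Re (cinner x y)"

instantiation complex :: chilbert_space
begin

definition scaleC_complex :: "complex \<Rightarrow> complex \<Rightarrow> complex"
  where "scaleC_complex a x = a * x"

definition cinner_complex :: "complex \<Rightarrow> complex \<Rightarrow> complex"
  where "cinner_complex x y = x * cnj y"

instance
  by standard
    (auto simp: scaleC_complex_def cinner_complex_def algebra_simps scaleR_conv_of_real
      inner_complex_def)

end


section \<open>Bounded operators\<close>

text \<open>
  Elements of \<^typ>\<open>'h \<Rightarrow>\<^sub>L 'h\<close> are bounded and real-linear; \<open>bounded_ops\<close> is the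
  algebra $B(H)$ of the complex-linear ones.
\<close>

type_synonym 'h op = "'h \<Rightarrow>\<^sub>L 'h"

definition bounded_ops :: "('h::chilbert_space) op set"
  where "bounded_ops = {T. \<forall>c x. blinfun_apply T (c *\<^sub>C x) = c *\<^sub>C blinfun_apply T x}"

definition op_scaleC :: "complex \<Rightarrow> ('h::chilbert_space) op \<Rightarrow> 'h op"
  where "op_scaleC c T = Blinfun (\<lambda>x. c *\<^sub>C blinfun_apply T x)"

definition op_adj :: "('h::chilbert_space) op \<Rightarrow> 'h op"
  where "op_adj T =
    (THE S. \<forall>x y. cinner (blinfun_apply S x) y = cinner x (blinfun_apply T y))"

definition op_pos :: "('h::chilbert_space) op \<Rightarrow> bool"
  where "op_pos T \<longleftrightarrow> (\<forall>x. cinner (blinfun_apply T x) x \<in> \<real>\<^sub>\<ge>\<^sub>0)"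

definition op_le :: "('h::chilbert_space) op \<Rightarrow> 'h op \<Rightarrow> bool"
  where "op_le S T \<longleftrightarrow> op_pos (T - S)"

definition projection :: "('h::chilbert_space) op \<Rightarrow> bool"
  where "projection e \<longleftrightarrow> e \<in> bounded_ops \<and> e o\<^sub>L e = e \<and> op_adj e = e"

definition scalar_ops :: "('h::chilbert_space) op set"
  where "scalar_ops = range (\<lambda>c. op_scaleC c id_blinfun)"

text \<open>
  The ultraweak topology is the initial topology of the functionals
  $T \mapsto \sum_n \langle T\xi_n, \eta_n\rangle$ with
  $\sum_n \|\xi_n\|^2, \sum_n \|\eta_n\|^2 < \infty$.
\<close>

definition square_summable :: "(nat \<Rightarrow> 'h::chilbert_space) \<Rightarrow> bool"
  where "square_summable \<xi> \<longleftrightarrow> summable (\<lambda>n. (norm (\<xi> n))\<^sup>2)"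

definition ultraweak_topology :: "('h::chilbert_space) op topology"
  where "ultraweak_topology = topology_generated_by
    {{T. (\<Sum>n. cinner (blinfun_apply T (\<xi> n)) (\<eta> n)) \<in> U} | \<xi> \<eta> U.
       square_summable \<xi> \<and> square_summable \<eta> \<and> open U}"


section \<open>Von Neumann algebras and factors\<close>

definition commutant :: "('h::chilbert_space) op set \<Rightarrow> 'h op set"
  where "commutant S = {T \<in> bounded_ops. \<forall>A\<in>S. T o\<^sub>L A = A o\<^sub>L T}"

definition von_neumann_algebra :: "('h::chilbert_space) op set \<Rightarrow> bool"
  where "von_neumann_algebra M \<longleftrightarrow>
    M \<subseteq> bounded_ops \<and> (\<forall>x\<in>M. op_adj x \<in> M) \<and> commutant (commutant M) = M"

definition factor :: "('h::chilbert_space) op set \<Rightarrow> bool"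
  where "factor M \<longleftrightarrow> von_neumann_algebra M \<and> M \<inter> commutant M = scalar_ops"

text \<open>
  Faithful normal tracial state on \<open>A\<close>. The unit \<open>e\<close> of \<open>A\<close> is a parameter because
  \<open>A\<close> may be a corner $pBp$, whose unit is $p$. Such a \<open>\<tau>\<close> is determined by a factor \<open>A\<close>
  only on \<open>A\<close>; its values elsewhere are irrelevant.
\<close>

definition tracial_state ::
  "('h::chilbert_space) op set \<Rightarrow> 'h op \<Rightarrow> ('h op \<Rightarrow> complex) \<Rightarrow> bool"
  where "tracial_state A e \<tau> \<longleftrightarrow>
    (\<forall>x\<in>A. \<forall>y\<in>A. \<tau> (x + y) = \<tau> x + \<tau> y) \<and>
    (\<forall>c. \<forall>x\<in>A. \<tau> (op_scaleC c x) = c * \<tau> x) \<and>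
    \<tau> e = 1 \<and>
    (\<forall>x\<in>A. \<tau> (op_adj x o\<^sub>L x) \<in> \<real>\<^sub>\<ge>\<^sub>0) \<and>
    (\<forall>x\<in>A. \<tau> (op_adj x o\<^sub>L x) = 0 \<longrightarrow> x = 0) \<and>
    (\<forall>x\<in>A. \<forall>y\<in>A. \<tau> (x o\<^sub>L y) = \<tau> (y o\<^sub>L x)) \<and>
    continuous_map (subtopology ultraweak_topology A) euclidean \<tau>"

definition the_trace :: "('h::chilbert_space) op set \<Rightarrow> 'h op \<Rightarrow> 'h op \<Rightarrow> complex"
  where "the_trace A e = (SOME \<tau>. tracial_state A e \<tau>)"

text \<open>The span below is the real one; this does not affect infinite-dimensionality.\<close>

definition II1_factor :: "('h::chilbert_space) op set \<Rightarrow> bool"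
  where "II1_factor M \<longleftrightarrow> factor M \<and> (\<nexists>B. finite B \<and> M \<subseteq> span B) \<and>
    (\<exists>\<tau>. tracial_state M id_blinfun \<tau>)"


section \<open>The Jones index\<close>

definition corner :: "('h::chilbert_space) op set \<Rightarrow> 'h op \<Rightarrow> 'h op set"
  where "corner A p = {p o\<^sub>L x o\<^sub>L p | x. x \<in> A}"

text \<open>
  For a factor \<open>A\<close>, a projection \<open>p\<close> in \<open>A\<close> is finite iff the factor $pAp$ carries a
  faithful normal tracial state; this excludes $p = 0$.
\<close>

definition finite_corner :: "('h::chilbert_space) op set \<Rightarrow> 'h op \<Rightarrow> bool"
  where "finite_corner A p \<longleftrightarrow> (\<exists>\<tau>. tracial_state (corner A p) p \<tau>)"

definition cyclic_projection :: "('h::chilbert_space) op set \<Rightarrow> 'h \<Rightarrow> 'h op"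
  where "cyclic_projection A \<xi> =
    (THE e. projection e \<and>
       range (blinfun_apply e) = closure ((\<lambda>T. blinfun_apply T \<xi>) ` A))"

text \<open>
  The Murray--von Neumann coupling constant $\dim_A(K)$ of a finite factor $A$ acting by
  restriction on $K = pH$, where $p \in A'$ is a nonzero projection. The commutant of $A$
  on $K$ is $pA'p$; if it is finite, then for any nonzero $\xi \in K$
  $$\dim_A(K) = \mathrm{tr}_A([A'\xi]) \,/\, \mathrm{tr}_{pA'p}([A\xi]),$$
  and $\dim_A(K) = \infty$ otherwise. Here the projection of $K$ onto the closure of
  $pA'p\,\xi$ is the restriction to $K$ of $[A'\xi] \in A$, and $A$ is isomorphic to its
  restriction to $K$, so the numerator is the trace on $A$ itself.
\<close>

definition module_dim :: "('h::chilbert_space) op set \<Rightarrow> 'h op \<Rightarrow> ennreal"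
  where "module_dim A p =
    (if finite_corner (commutant A) p then
       (let \<xi> = (SOME \<xi>. \<xi> \<noteq> 0 \<and> blinfun_apply p \<xi> = \<xi>) in
        ennreal (Re (the_trace A id_blinfun (cyclic_projection (commutant A) \<xi>)) /
                 Re (the_trace (corner (commutant A) p) p (cyclic_projection A \<xi>))))
     else \<infinity>)"

text \<open>
  $[M:N] = \dim_N(K) / \dim_M(K)$ for any $M$-module $K$ on which the commutant of $M$
  is finite; for $K = L^2(M)$ the denominator is $1$. The given space $H$ need not
  contain a copy of $L^2(M)$, but it always contains such a $K = pH$ with $p \in M'$,
  for instance the closure of $M\xi$ with $\xi \neq 0$.
\<close>

definition jones_index :: "('h::chilbert_space) op set \<Rightarrow> 'h op set \<Rightarrow> ennreal"
  where "jones_index M N =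
    (let p = (SOME p. p \<in> commutant M \<and> projection p \<and> finite_corner (commutant M) p)
     in module_dim N p / module_dim M p)"


section \<open>Bimodule quantum channels\<close>

definition linear_map_on ::
  "('h::chilbert_space) op set \<Rightarrow> ('h op \<Rightarrow> 'h op) \<Rightarrow> bool"
  where "linear_map_on M \<Phi> \<longleftrightarrow>
    (\<forall>x\<in>M. \<forall>y\<in>M. \<Phi> (x + y) = \<Phi> x + \<Phi> y) \<and>
    (\<forall>c. \<forall>x\<in>M. \<Phi> (op_scaleC c x) = op_scaleC c (\<Phi> x))"

definition normal_map_on ::
  "('h::chilbert_space) op set \<Rightarrow> ('h op \<Rightarrow> 'h op) \<Rightarrow> bool"
  where "normal_map_on M \<Phi> \<longleftrightarrow>
    continuous_map (subtopology ultraweak_topology M) (subtopology ultraweak_topology M) \<Phi>"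

text \<open>Positivity of the operator matrix $(x_{ij})_{i,j<n}$ on $H^n$.\<close>

definition matrix_pos :: "nat \<Rightarrow> (nat \<Rightarrow> nat \<Rightarrow> ('h::chilbert_space) op) \<Rightarrow> bool"
  where "matrix_pos n x \<longleftrightarrow>
    (\<forall>\<xi>. (\<Sum>i<n. \<Sum>j<n. cinner (blinfun_apply (x i j) (\<xi> j)) (\<xi> i)) \<in> \<real>\<^sub>\<ge>\<^sub>0)"

definition completely_positive_on ::
  "('h::chilbert_space) op set \<Rightarrow> ('h op \<Rightarrow> 'h op) \<Rightarrow> bool"
  where "completely_positive_on M \<Phi> \<longleftrightarrow>
    (\<forall>n x. (\<forall>i<n. \<forall>j<n. x i j \<in> M) \<and> matrix_pos n x
       \<longrightarrow> matrix_pos n (\<lambda>i j. \<Phi> (x i j)))"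

definition bimodule_channel ::
  "('h::chilbert_space) op set \<Rightarrow> 'h op set \<Rightarrow> ('h op \<Rightarrow> 'h op) \<Rightarrow> bool"
  where "bimodule_channel M Q \<Phi> \<longleftrightarrow>
    von_neumann_algebra M \<and> von_neumann_algebra Q \<and> Q \<subseteq> M \<and>
    (\<forall>x\<in>M. \<Phi> x \<in> M) \<and> linear_map_on M \<Phi> \<and> normal_map_on M \<Phi> \<and>
    \<Phi> id_blinfun = id_blinfun \<and> completely_positive_on M \<Phi> \<and>
    (\<forall>x\<in>M. \<forall>y1\<in>Q. \<forall>y2\<in>Q. \<Phi> (y1 o\<^sub>L x o\<^sub>L y2) = y1 o\<^sub>L \<Phi> x o\<^sub>L y2)"

definition relatively_irreducible ::
  "('h::chilbert_space) op set \<Rightarrow> 'h op set \<Rightarrow> ('h op \<Rightarrow> 'h op) \<Rightarrow> bool"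
  where "relatively_irreducible M Q \<Phi> \<longleftrightarrow>
    (\<forall>p\<in>M. projection p \<and> (\<exists>c::real. c > 0 \<and> op_le (\<Phi> p) (c *\<^sub>R p)) \<longrightarrow> p \<in> Q)"

end

theory Submission
  imports Defs
begin

text \<open>
  Let $\tau$ be the trace of \<open>M\<close>. The functional $\omega = \tau \circ \Phi - \tau$ is ultraweakly
  continuous, vanishes at $1$ and is invariant under conjugation by the unitaries of \<open>N\<close>. Among the
  $z \in M$ with $\|z\| \le \|x\|$ and $\omega(z) = \omega(x)$, an ultraweakly compact convex set,
  there is exactly one that minimises $\tau(z^*z)$; it commutes with \<open>N\<close>, hence is scalar by
  irreducibility, and $\omega(x) = \omega(z) = 0$. So $\Phi$ preserves the faithful state $\tau$. By the
  Kadison--Schwarz inequality the fixed points lie in the multiplicative domain of $\Phi$, and they form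
  a von Neumann algebra by normality and the bicommutant theorem; its centre lies in
  $N' \cap M$. If $\Phi(p) \le cp$, then $\Phi(p)$ is supported on \<open>p\<close>, so $\Phi(p) \le p$, with
  equality since both have the same trace.
\<close>

section \<open>Complex Hilbert spaces\<close>

text \<open>The obstacle is that nothing in the hypotheses says that \<Phi> preserves a trace, while
  every later step rests on a positive element of trace zero having to vanish. Averaging over the
  unitary group of \<open>N\<close> would be the natural way to compare \<tau> \<circ> \<Phi> with
  \<tau>; minimising the 2-norm takes the place of the average. Conjugation by a unitary u of
  \<open>N\<close> changes neither the norm nor the value of \<omega> nor the 2-norm, so it sends a
  minimiser to a minimiser, and uniqueness makes the minimiser commute with u. Two features of the
  definitions shape the preparations. Normality refers to the ultraweak topology, whose functionals
  are infinite sums, so density in the bicommutant is proved on a direct sum of countably many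
  copies of the Hilbert space. And \<open>tracial_state\<close> gives positivity only on products
  \<open>op_adj x o\<^sub>L x\<close>, so square roots are needed before the trace can be applied to
  operators that are positive in the sense of quadratic forms.\<close>

instance chilbert_space \<subseteq> banach ..

lemma cinner_add_right: "cinner x (y + z) = cinner x y + cinner x (z::'h::chilbert_space)"
  by (metis cinner_add_left cinner_commute complex_cnj_add)

lemma cinner_scaleC_right: "cinner x (a *\<^sub>C y) = cnj a * cinner x (y::'h::chilbert_space)"
  by (metis cinner_commute cinner_scaleC_left complex_cnj_mult)

lemma cinner_scaleR_left: "cinner (r *\<^sub>R x) y = of_real r * cinner x (y::'h::chilbert_space)"
  by (metis cinner_scaleC_left scaleC_of_real)

lemma cinner_scaleR_right: "cinner x (r *\<^sub>R y) = of_real r * cinner x (y::'h::chilbert_space)"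
  by (metis cinner_scaleC_right scaleC_of_real complex_cnj_complex_of_real)

lemma cinner_zero_left [simp]: "cinner 0 (y::'h::chilbert_space) = 0"
  using cinner_scaleR_left[of 0 0 y] by simp

lemma cinner_zero_right [simp]: "cinner (x::'h::chilbert_space) 0 = 0"
  using cinner_scaleR_right[of x 0 0] by simp

lemma cinner_minus_left [simp]: "cinner (- x) (y::'h::chilbert_space) = - cinner x y"
  using cinner_scaleR_left[of "-1" x y] by simp

lemma cinner_minus_right [simp]: "cinner (x::'h::chilbert_space) (- y) = - cinner x y"
  using cinner_scaleR_right[of x "-1" y] by simp

lemma cinner_diff_left: "cinner (x - y) z = cinner x z - cinner y (z::'h::chilbert_space)"
  using cinner_add_left[of x "- y" z] by simp

lemma cinner_diff_right: "cinner x (y - z) = cinner x y - cinner x (z::'h::chilbert_space)"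
  using cinner_add_right[of x y "- z"] by simp

lemmas cinner_linear = cinner_add_left cinner_add_right cinner_diff_left cinner_diff_right
  cinner_scaleC_left cinner_scaleC_right cinner_scaleR_left cinner_scaleR_right

lemma cinner_self: "cinner x x = of_real ((norm (x::'h::chilbert_space))\<^sup>2)"
proof -
  have "cinner x x \<in> \<real>"
    by (metis cinner_commute Reals_cnj_iff)
  moreover have "Re (cinner x x) = (norm x)\<^sup>2"
    by (metis inner_eq_Re_cinner power2_norm_eq_inner)
  ultimately show ?thesis
    by (metis of_real_Re)
qed

lemma Im_cinner: "Im (cinner x y) = inner x (\<i> *\<^sub>C (y::'h::chilbert_space))"
  by (simp add: inner_eq_Re_cinner cinner_scaleC_right)

lemma norm_scaleC: "norm (a *\<^sub>C x) = cmod a * norm (x::'h::chilbert_space)"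
proof -
  have "complex_of_real ((norm (a *\<^sub>C x))\<^sup>2) = a * cnj a * of_real ((norm x)\<^sup>2)"
    by (metis cinner_self cinner_scaleC_left cinner_scaleC_right mult.assoc mult.left_commute)
  also have "\<dots> = of_real ((cmod a * norm x)\<^sup>2)"
    unfolding power_mult_distrib of_real_mult complex_norm_square ..
  finally have "(norm (a *\<^sub>C x))\<^sup>2 = (cmod a * norm x)\<^sup>2"
    using of_real_eq_iff by blast
  then show ?thesis
    by (simp add: power2_eq_iff_nonneg)
qed

text \<open>Multiplying x by a phase makes the complex inner product real and nonnegative, which
  reduces the claim to the real Cauchy--Schwarz inequality.\<close>

lemma norm_cinner_le: "cmod (cinner x y) \<le> norm x * norm (y::'h::chilbert_space)"
proof (cases "cinner x y = 0")
  case False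
  define a where "a = cnj (cinner x y) / of_real (cmod (cinner x y))"
  have a: "cmod a = 1"
    using False by (simp add: a_def norm_divide)
  have "a * cinner x y = of_real (cmod (cinner x y))"
    using False by (simp add: a_def complex_norm_square[symmetric] power2_eq_square mult.commute)
  then have "cmod (cinner x y) = inner (a *\<^sub>C x) y"
    by (simp add: inner_eq_Re_cinner cinner_scaleC_left)
  also have "\<dots> \<le> norm (a *\<^sub>C x) * norm y"
    by (rule norm_cauchy_schwarz)
  finally show ?thesis
    by (simp add: norm_scaleC a)
qed simp

lemma bounded_bilinear_cinner: "bounded_bilinear (cinner :: 'h::chilbert_space \<Rightarrow> 'h \<Rightarrow> complex)"
  by (rule bounded_bilinear.intro)
    (auto simp: cinner_linear scaleR_conv_of_real intro!: exI[of _ 1] norm_cinner_le)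

lemma cinner_eqI: "x = (z::'h::chilbert_space)" if "\<And>y. cinner x y = cinner z y"
proof -
  have "cinner (x - z) (x - z) = 0"
    using that by (simp add: cinner_diff_left)
  then show ?thesis
    by (simp add: cinner_self)
qed

lemma bounded_linear_scaleC: "bounded_linear ((*\<^sub>C) a :: 'h::chilbert_space \<Rightarrow> 'h)"
proof (rule bounded_linear_intro[where K = "cmod a"])
  show "a *\<^sub>C (r *\<^sub>R x) = r *\<^sub>R (a *\<^sub>C x)" for r and x :: 'h
    by (metis scaleC_of_real scaleC_scaleC mult.commute)
qed (simp_all add: scaleC_add_right norm_scaleC mult.commute)

lemma scaleC_one [simp]: "1 *\<^sub>C (x::'h::chilbert_space) = x"
  using scaleC_of_real[of 1 x] by simp

lemma scaleC_zero_right [simp]: "a *\<^sub>C (0::'h::chilbert_space) = 0"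
  by (rule bounded_linear.linear[OF bounded_linear_scaleC, THEN linear_0])

lemma scaleC_minus_one: "(-1) *\<^sub>C (x::'h::chilbert_space) = - x"
  using scaleC_of_real[of "-1" x] by simp

lemma scaleC_diff_right: "a *\<^sub>C (x - y) = a *\<^sub>C x - a *\<^sub>C (y::'h::chilbert_space)"
  by (rule bounded_linear.linear[OF bounded_linear_scaleC, THEN linear_diff])

lemma nonneg_Reals_iff: "z \<in> \<real>\<^sub>\<ge>\<^sub>0 \<longleftrightarrow> Im z = 0 \<and> 0 \<le> Re z"
  by (auto simp: complex_nonneg_Reals_iff)

subsection \<open>Orthogonal projections and Riesz representation\<close>

text \<open>The midpoint of two almost nearest points lies in X and is therefore at distance at
  least d from x; by the parallelogram law the two points are close, so a minimising sequence is
  Cauchy.\<close>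

lemma closed_subspace_nearest:
  fixes X :: "'a::{real_inner, complete_space} set"
  assumes "subspace X" "closed X"
  obtains y where "y \<in> X" "\<And>z. z \<in> X \<Longrightarrow> norm (x - y) \<le> norm (x - z)"
proof -
  define d where "d = infdist x X"
  have ne: "X \<noteq> {}"
    using assms(1) subspace_0 by blast
  have dle: "d \<le> norm (x - z)" if "z \<in> X" for z
    using infdist_le[OF that, of x] by (simp add: d_def dist_norm)
  have d0: "0 \<le> d"
    by (simp add: d_def infdist_nonneg)
  have "\<exists>z\<in>X. norm (x - z) < d + 1 / real (Suc n)" for n
    using infdist_attains_inf ne cInf_lessD[of "(\<lambda>z. dist x z) ` X" "d + 1 / real (Suc n)"]
    by (auto simp: d_def infdist_notempty dist_norm)
  then obtain z where z: "\<And>n. z n \<in> X" "\<And>n. norm (x - z n) < d + 1 / real (Suc n)"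
    by metis
  have par: "(norm (z m - z n))\<^sup>2 \<le> 2 * (norm (x - z m))\<^sup>2 + 2 * (norm (x - z n))\<^sup>2 - 4 * d\<^sup>2" for m n
  proof -
    have "(1/2) *\<^sub>R (z m + z n) \<in> X"
      using z assms(1) by (simp add: subspace_add subspace_scale)
    then have "d \<le> norm (x - (1/2) *\<^sub>R (z m + z n))"
      by (rule dle)
    then have "d\<^sup>2 \<le> (norm (x - (1/2) *\<^sub>R (z m + z n)))\<^sup>2"
      using d0 by (simp add: power_mono)
    moreover have "(norm (z m - z n))\<^sup>2 + 4 * (norm (x - (1/2) *\<^sub>R (z m + z n)))\<^sup>2
        = 2 * (norm (x - z m))\<^sup>2 + 2 * (norm (x - z n))\<^sup>2"
      by (simp add: power2_norm_eq_inner inner_diff_left inner_diff_right inner_add_left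
          inner_add_right inner_commute algebra_simps)
    ultimately show ?thesis
      by linarith
  qed
  have lim: "(\<lambda>n. norm (x - z n)) \<longlonglongrightarrow> d"
  proof (rule tendsto_sandwich[OF _ _ tendsto_const])
    show "(\<lambda>n. d + 1 / real (Suc n)) \<longlonglongrightarrow> d"
      using tendsto_add[OF tendsto_const[of d] LIMSEQ_inverse_real_of_nat]
      by (simp add: inverse_eq_divide)
  qed (use z dle in \<open>auto intro!: always_eventually less_imp_le\<close>)
  have "Cauchy z"
  proof (rule metric_CauchyI)
    fix e :: real
    assume e: "0 < e"
    have "(\<lambda>n. (norm (x - z n))\<^sup>2) \<longlonglongrightarrow> d\<^sup>2"
      using lim by (rule tendsto_power)
    then have "\<forall>\<^sub>F n in sequentially. (norm (x - z n))\<^sup>2 < d\<^sup>2 + e\<^sup>2 / 4"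
      using e by (intro order_tendstoD) auto
    then obtain k where k: "\<And>n. n \<ge> k \<Longrightarrow> (norm (x - z n))\<^sup>2 < d\<^sup>2 + e\<^sup>2 / 4"
      by (auto simp: eventually_sequentially)
    show "\<exists>k. \<forall>m\<ge>k. \<forall>n\<ge>k. dist (z m) (z n) < e"
    proof (intro exI allI impI)
      fix m n
      assume "k \<le> m" "k \<le> n"
      then have "(norm (z m - z n))\<^sup>2 < e\<^sup>2"
        using par[of m n] k[of m] k[of n] by linarith
      then show "dist (z m) (z n) < e"
        using e by (simp add: dist_norm power2_less_imp_less)
    qed
  qed
  then obtain y where y: "z \<longlonglongrightarrow> y"
    using Cauchy_convergent convergent_def by blast
  have "y \<in> X"
    using closed_sequentially[OF assms(2)] z(1) y by blast
  moreover have "norm (x - y) = d"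
    using LIMSEQ_unique[OF lim] tendsto_norm[OF tendsto_diff[OF tendsto_const y]] by blast
  ultimately show ?thesis
    using dle that by force
qed

lemma orthogonal_projection_exists:
  fixes X :: "'a::{real_inner, complete_space} set"
  assumes "subspace X" "closed X"
  obtains y where "y \<in> X" "\<And>z. z \<in> X \<Longrightarrow> inner (x - y) z = 0"
proof -
  obtain y where y: "y \<in> X" "\<And>z. z \<in> X \<Longrightarrow> norm (x - y) \<le> norm (x - z)"
    using closed_subspace_nearest[OF assms] by blast
  have "inner (x - y) z = 0" if z: "z \<in> X" for z
  proof (cases "z = 0")
    case False
    \<comment> \<open>This t minimises the norm of (x - y) - t z, so a nonzero inner product would
      give a point of X nearer than y.\<close>
    define t where "t = inner (x - y) z / (norm z)\<^sup>2"
    have "y + t *\<^sub>R z \<in> X"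
      using y z assms(1) by (simp add: subspace_add subspace_scale)
    then have "(norm (x - y))\<^sup>2 \<le> (norm ((x - y) - t *\<^sub>R z))\<^sup>2"
      using y(2) by (simp add: diff_diff_eq power_mono)
    also have "\<dots> = (norm (x - y))\<^sup>2 - (inner (x - y) z)\<^sup>2 / (norm z)\<^sup>2"
    proof -
      have "(norm ((x - y) - t *\<^sub>R z))\<^sup>2
          = (norm (x - y))\<^sup>2 - 2 * t * inner (x - y) z + t\<^sup>2 * (norm z)\<^sup>2"
        unfolding power2_norm_eq_inner
        by (simp add: inner_commute algebra_simps power2_eq_square)
      also have "\<dots> = (norm (x - y))\<^sup>2 - (inner (x - y) z)\<^sup>2 / (norm z)\<^sup>2"
        using False by (simp add: t_def field_simps power2_eq_square)
      finally show ?thesis .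
    qed
    finally have "(inner (x - y) z)\<^sup>2 / (norm z)\<^sup>2 \<le> 0"
      by simp
    then show ?thesis
      using False by (simp add: divide_le_0_iff)
  qed simp
  then show ?thesis
    using y that by blast
qed

text \<open>The residual being orthogonal to X determines the nearest point uniquely, and this
  characterisation is stable under sums and multiples, whence linearity.\<close>

lemma orthogonal_projection_blinfun:
  fixes X :: "'a::{real_inner, complete_space} set"
  assumes "subspace X" "closed X"
  obtains \<pi> :: "'a \<Rightarrow>\<^sub>L 'a" where
    "\<And>x. \<pi> x \<in> X" "\<And>x z. z \<in> X \<Longrightarrow> inner (x - \<pi> x) z = 0"
proof -
  have "\<exists>y. y \<in> X \<and> (\<forall>z\<in>X. inner (x - y) z = 0)" for x
    using orthogonal_projection_exists[OF assms, of x] by metis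
  then obtain p where p: "\<And>x. p x \<in> X" "\<And>x z. z \<in> X \<Longrightarrow> inner (x - p x) z = 0"
    by metis
  have uniq: "p x = y" if "y \<in> X" "\<And>z. z \<in> X \<Longrightarrow> inner (x - y) z = 0" for x y
  proof -
    have "p x - y \<in> X"
      using p(1) that(1) assms(1) by (simp add: subspace_diff)
    then have "inner (x - y) (p x - y) - inner (x - p x) (p x - y) = 0"
      using p(2) that(2) by simp
    then have "inner (p x - y) (p x - y) = 0"
      by (simp flip: inner_diff_left)
    then show ?thesis
      by simp
  qed
  have "bounded_linear p"
  proof (rule bounded_linear_intro[where K = 1])
    show "p (x + y) = p x + p y" for x y
    proof (rule uniq)
      show "inner (x + y - (p x + p y)) z = 0" if "z \<in> X" for z
        using p(2)[OF that, of x] p(2)[OF that, of y] by (simp add: inner_diff_left inner_add_left)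
    qed (simp add: p assms subspace_add)
    show "p (r *\<^sub>R x) = r *\<^sub>R p x" for r x
    proof (rule uniq)
      show "inner (r *\<^sub>R x - r *\<^sub>R p x) z = 0" if "z \<in> X" for z
        using p(2)[OF that, of x] by (simp flip: scaleR_right_diff_distrib)
    qed (simp add: p assms subspace_scale)
    show "norm (p x) \<le> norm x * 1" for x
    proof -
      have "inner (x - p x) (p x) = 0"
        using p by blast
      then have "norm (p x) * norm (p x) = inner x (p x)"
        by (simp add: inner_diff_left flip: power2_norm_eq_inner power2_eq_square)
      also have "\<dots> \<le> norm x * norm (p x)"
        by (rule norm_cauchy_schwarz)
      finally show ?thesis
        by (cases "p x = 0") auto
    qed
  qed
  then show ?thesis
    using that[of "Blinfun p"] p by (simp add: bounded_linear_Blinfun_apply)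
qed

lemma riesz_representation:
  fixes f :: "'a::{real_inner, complete_space} \<Rightarrow> real"
  assumes "bounded_linear f"
  obtains v where "\<And>x. f x = inner x v"
proof (cases "\<forall>x. f x = 0")
  case True
  then show ?thesis
    using that[of 0] by simp
next
  case False
  then obtain x0 where x0: "f x0 \<noteq> 0"
    by blast
  interpret f: bounded_linear f
    by fact
  have sub: "subspace {x. f x = 0}"
    by (simp add: subspace_def f.zero f.add f.scaleR)
  have cl: "closed {x. f x = 0}"
    by (intro closed_Collect_eq continuous_intros f.continuous_on)
  obtain k where k: "f k = 0" "\<And>z. f z = 0 \<Longrightarrow> inner (x0 - k) z = 0"
    using orthogonal_projection_exists[OF sub cl, of x0] by auto
  define w where "w = x0 - k"
  have fw: "f w \<noteq> 0"
    using x0 k by (simp add: w_def f.diff)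
  then have w: "w \<noteq> 0"
    using f.zero by auto
  \<comment> \<open>The kernel of f has codimension one and w is orthogonal to it: subtracting a
    multiple of w moves x into the kernel, which fixes the scaling of the representing
    vector.\<close>
  have "f x = inner x ((f w / (norm w)\<^sup>2) *\<^sub>R w)" for x
  proof -
    have "f (x - (f x / f w) *\<^sub>R w) = 0"
      using fw by (simp add: f.diff f.scaleR)
    then have "inner w (x - (f x / f w) *\<^sub>R w) = 0"
      using k by (simp add: w_def)
    then have "inner x w = f x / f w * (norm w)\<^sup>2"
      by (simp add: inner_diff_right power2_norm_eq_inner inner_commute)
    then show ?thesis
      using w fw by simp
  qed
  then show ?thesis
    using that by blast
qed

section \<open>Bounded operators\<close>

lemma op_apply_simps [simp]:
  "blinfun_apply (S + T) x = S x + T x" "blinfun_apply (S - T) x = S x - T x"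
  "blinfun_apply (r *\<^sub>R T) x = r *\<^sub>R T x" "blinfun_apply (- T) x = - T x"
  by (simp_all add: blinfun.bilinear_simps)

lemma op_scaleC_apply [simp]:
  "blinfun_apply (op_scaleC c T) x = c *\<^sub>C blinfun_apply (T::('h::chilbert_space) op) x"
  unfolding op_scaleC_def
  by (rule bounded_linear_Blinfun_apply[THEN fun_cong])
    (rule bounded_linear_compose[OF bounded_linear_scaleC blinfun.bounded_linear_right])

text \<open>Riesz representation is applied to the real part in the second argument; the imaginary
  part is recovered from Im f(x, y) = Re f(x, \<i>y). The result yields adjoints, and later turns
  limits of sesquilinear forms back into operators.\<close>

lemma sesquilinear_representation:
  fixes f :: "'h::chilbert_space \<Rightarrow> 'h \<Rightarrow> complex"
  assumes add1: "\<And>x y z. f (x + y) z = f x z + f y z"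
    and add2: "\<And>x y z. f x (y + z) = f x y + f x z"
    and scale1: "\<And>c x y. f (c *\<^sub>C x) y = c * f x y"
    and scale2: "\<And>c x y. f x (c *\<^sub>C y) = cnj c * f x y"
    and bound: "\<And>x y. cmod (f x y) \<le> R * norm x * norm y"
  obtains T where "T \<in> bounded_ops" "\<And>x y. cinner (blinfun_apply T x) y = f x y"
    "\<And>x. norm (blinfun_apply T x) \<le> R * norm x"
proof -
  have "\<exists>v. \<forall>y. Re (f x y) = inner y v" for x
  proof -
    have "bounded_linear (\<lambda>y. Re (f x y))"
    proof (rule bounded_linear_intro[where K = "R * norm x"])
      show "Re (f x (r *\<^sub>R y)) = r *\<^sub>R Re (f x y)" for r y
        using scale2[of x "of_real r" y] by (simp add: scaleC_of_real)
      show "norm (Re (f x y)) \<le> norm y * (R * norm x)" for y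
        using bound[of x y] abs_Re_le_cmod[of "f x y"] by (simp add: mult_ac)
    qed (simp add: add2)
    then show ?thesis
      using riesz_representation by metis
  qed
  then obtain t where t: "\<And>x y. Re (f x y) = inner y (t x)"
    by metis
  have ct: "cinner (t x) y = f x y" for x y
  proof (rule complex_eqI)
    show "Re (cinner (t x) y) = Re (f x y)"
      by (metis t inner_commute inner_eq_Re_cinner)
    have "Im (f x y) = Re (f x (\<i> *\<^sub>C y))"
      by (simp add: scale2)
    then show "Im (cinner (t x) y) = Im (f x y)"
      by (metis t inner_commute Im_cinner)
  qed
  have nt: "norm (t x) \<le> R * norm x" for x
  proof -
    have "norm (t x) * norm (t x) = cmod (f x (t x))"
      by (simp add: cinner_self norm_power power2_eq_square norm_mult flip: ct)
    also have "\<dots> \<le> R * norm x * norm (t x)"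
      by (rule bound)
    finally have "norm (t x) \<le> R * norm x \<or> t x = 0"
      by auto
    moreover have "0 \<le> R * norm x"
      using order_trans[OF norm_ge_zero bound[of x x]]
      by (cases "x = 0") (auto simp: zero_le_mult_iff)
    ultimately show ?thesis
      by auto
  qed
  have bl: "bounded_linear t"
  proof (rule bounded_linear_intro[where K = R])
    show "t (x + y) = t x + t y" for x y
      by (rule cinner_eqI) (simp add: ct add1 cinner_add_left)
    show "t (r *\<^sub>R x) = r *\<^sub>R t x" for r x
      by (rule cinner_eqI)
        (use scale1[of "of_real r" x] in \<open>simp add: ct scaleC_of_real cinner_scaleR_left\<close>)
  qed (simp add: nt mult.commute)
  have "t (c *\<^sub>C x) = c *\<^sub>C t x" for c x
    by (rule cinner_eqI) (simp add: ct scale1 cinner_scaleC_left)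
  then show ?thesis
    using that[of "Blinfun t"] bl ct nt by (simp add: bounded_linear_Blinfun_apply bounded_ops_def)
qed

section \<open>Adjoints and quadratic forms of bounded operators\<close>

lemma bounded_ops_scaleC: "T \<in> bounded_ops \<Longrightarrow> blinfun_apply T (c *\<^sub>C x) = c *\<^sub>C T x"
  by (simp add: bounded_ops_def)

text \<open>Since \<open>op_adj\<close> is a definite description, nothing can be said about it
  before existence and uniqueness are known; both hold because T is complex-linear and
  bounded.\<close>

lemma op_adj_works:
  assumes "T \<in> bounded_ops"
  shows "cinner (blinfun_apply (op_adj T) x) y = cinner x (blinfun_apply T y)"
    and "op_adj T \<in> bounded_ops" and "norm (op_adj T) \<le> norm T"
proof -
  obtain S where S: "S \<in> bounded_ops" "\<And>x y. cinner (blinfun_apply S x) y = cinner x (T y)"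
    "\<And>x. norm (blinfun_apply S x) \<le> norm T * norm x"
  proof (rule sesquilinear_representation[of "\<lambda>x y. cinner x (T y)" "norm T"])
    show "cmod (cinner x (T y)) \<le> norm T * norm x * norm y" for x y
    proof -
      have "cmod (cinner x (T y)) \<le> norm x * norm (T y)"
        by (rule norm_cinner_le)
      also have "\<dots> \<le> norm x * (norm T * norm y)"
        by (intro mult_left_mono norm_blinfun) auto
      finally show ?thesis
        by (simp add: mult_ac)
    qed
  qed (simp_all add: cinner_linear bounded_ops_scaleC[OF assms] blinfun.add_right)
  have "op_adj T = S"
    unfolding op_adj_def
  proof (rule the_equality)
    show "R = S" if "\<forall>x y. cinner (blinfun_apply R x) y = cinner x (T y)" for R
      by (rule blinfun_eqI, rule cinner_eqI) (simp add: that S(2))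
  qed (use S in simp)
  then show "cinner (op_adj T x) y = cinner x (T y)" "op_adj T \<in> bounded_ops"
    "norm (op_adj T) \<le> norm T"
    using S by (auto intro: norm_blinfun_bound)
qed

lemma op_adj_right:
  "T \<in> bounded_ops \<Longrightarrow> cinner x (blinfun_apply (op_adj T) y) = cinner (blinfun_apply T x) y"
  by (metis cinner_commute op_adj_works(1))

lemma op_adj_eqI:
  assumes "T \<in> bounded_ops" "\<And>x y. cinner (blinfun_apply S x) y = cinner x (blinfun_apply T y)"
  shows "op_adj T = S"
  by (rule blinfun_eqI, rule cinner_eqI) (simp add: assms op_adj_works)

lemma bounded_ops_intros [intro, simp]:
  "S \<in> bounded_ops \<Longrightarrow> T \<in> bounded_ops \<Longrightarrow> S + T \<in> bounded_ops"
  "S \<in> bounded_ops \<Longrightarrow> T \<in> bounded_ops \<Longrightarrow> S - T \<in> bounded_ops"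
  "S \<in> bounded_ops \<Longrightarrow> T \<in> bounded_ops \<Longrightarrow> S o\<^sub>L T \<in> bounded_ops"
  "T \<in> bounded_ops \<Longrightarrow> r *\<^sub>R T \<in> bounded_ops"
  "T \<in> bounded_ops \<Longrightarrow> op_scaleC c T \<in> bounded_ops"
  by (simp_all add: bounded_ops_def scaleC_add_right scaleC_diff_right scaleC_scaleC mult.commute
      flip: scaleC_of_real)

lemma id_bounded_ops [intro, simp]: "id_blinfun \<in> bounded_ops"
  by (simp add: bounded_ops_def)

lemma op_adj_simps:
  "S \<in> bounded_ops \<Longrightarrow> T \<in> bounded_ops \<Longrightarrow> op_adj (S + T) = op_adj S + op_adj T"
  "S \<in> bounded_ops \<Longrightarrow> T \<in> bounded_ops \<Longrightarrow> op_adj (S - T) = op_adj S - op_adj T"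
  "S \<in> bounded_ops \<Longrightarrow> T \<in> bounded_ops \<Longrightarrow> op_adj (S o\<^sub>L T) = op_adj T o\<^sub>L op_adj S"
  "T \<in> bounded_ops \<Longrightarrow> op_adj (r *\<^sub>R T) = r *\<^sub>R op_adj T"
  "T \<in> bounded_ops \<Longrightarrow> op_adj (op_scaleC c T) = op_scaleC (cnj c) (op_adj T)"
  "T \<in> bounded_ops \<Longrightarrow> op_adj (op_adj T) = T"
  by (auto intro!: op_adj_eqI simp: op_adj_works op_adj_right cinner_linear)

lemma op_adj_id [simp]: "op_adj id_blinfun = id_blinfun"
  by (rule op_adj_eqI) auto

lemma op_compose_simps:
  "(R + S) o\<^sub>L T = (R o\<^sub>L T) + (S o\<^sub>L T)" "(R - S) o\<^sub>L T = (R o\<^sub>L T) - (S o\<^sub>L T)"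
  "(r *\<^sub>R S) o\<^sub>L T = r *\<^sub>R (S o\<^sub>L T)" "R o\<^sub>L (S + T) = (R o\<^sub>L S) + (R o\<^sub>L T)"
  "R o\<^sub>L (S - T) = (R o\<^sub>L S) - (R o\<^sub>L T)" "R o\<^sub>L (r *\<^sub>R T) = r *\<^sub>R (R o\<^sub>L T)"
  "(- S) o\<^sub>L T = - (S o\<^sub>L T)" "R o\<^sub>L (- T) = - (R o\<^sub>L T)"
  "(R o\<^sub>L S) o\<^sub>L T = R o\<^sub>L (S o\<^sub>L T)"
  "id_blinfun o\<^sub>L T = T" "T o\<^sub>L id_blinfun = T"
  by (rule blinfun_eqI; simp add: blinfun.bilinear_simps)+

lemma op_scaleC_compose:
  "op_scaleC c S o\<^sub>L T = op_scaleC c (S o\<^sub>L T)"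
  "S \<in> bounded_ops \<Longrightarrow> S o\<^sub>L op_scaleC c T = op_scaleC c (S o\<^sub>L T)"
  by (rule blinfun_eqI; simp add: bounded_ops_scaleC)+

lemma op_scaleC_of_real: "op_scaleC (of_real r) T = r *\<^sub>R T"
  by (rule blinfun_eqI) (simp add: scaleC_of_real)

lemma op_scaleC_minus_one: "op_scaleC (-1) T = - T"
  by (rule blinfun_eqI) (simp add: scaleC_minus_one)

lemma op_scaleC_scaleC: "op_scaleC a (op_scaleC b T) = op_scaleC (a * b) T"
  by (rule blinfun_eqI) (simp add: scaleC_scaleC)

text \<open>Polarisation: the vectors x + y and x + \<i>y give the sum and the difference of the two
  mixed terms. The second vector is where complex linearity enters.\<close>

lemma op_eq_zeroI:
  assumes "T \<in> bounded_ops" "\<And>x. cinner (blinfun_apply T x) x = 0"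
  shows "T = 0"
proof -
  have "cinner (T x) y = 0" for x y
  proof -
    have "cinner (T x) y + cinner (T y) x = 0"
      using assms(2)[of "x + y"] assms(2)[of x] assms(2)[of y]
      by (simp add: blinfun.add_right cinner_linear add.commute)
    moreover
    have "- \<i> * cinner (T x) y + \<i> * cinner (T y) x = 0"
      using assms(2)[of "x + \<i> *\<^sub>C y"] assms(2)[of x] assms(2)[of y]
      by (simp add: blinfun.add_right cinner_linear bounded_ops_scaleC[OF assms(1)])
    then have "\<i> * (cinner (T y) x - cinner (T x) y) = 0"
      by (simp add: algebra_simps)
    ultimately show ?thesis
      by simp
  qed
  then have "T x = 0" for x
    using cinner_eqI[of "T x" 0] by simp
  then show ?thesis
    by (simp add: blinfun_eqI)
qed

text \<open>The quadratic form of a positive T is real, so the form of T minus its adjoint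
  vanishes.\<close>

lemma op_pos_adj:
  assumes "T \<in> bounded_ops" "op_pos T"
  shows "op_adj T = T"
proof -
  have "T - op_adj T = 0"
  proof (rule op_eq_zeroI)
    show "cinner ((T - op_adj T) x) x = 0" for x
      using assms cinner_commute[of x "T x"]
      by (auto simp: cinner_diff_left op_adj_works op_pos_def nonneg_Reals_iff complex_eq_iff)
  qed (simp add: assms op_adj_works)
  then show ?thesis
    by simp
qed

section \<open>Square-summable sequences\<close>

lemma norm_add_power2_le: "(norm (x + y))\<^sup>2 \<le> 2 * (norm x)\<^sup>2 + 2 * (norm (y::'a::real_inner))\<^sup>2"
proof -
  have "(norm (x + y))\<^sup>2 + (norm (x - y))\<^sup>2 = 2 * (norm x)\<^sup>2 + 2 * (norm y)\<^sup>2"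
    by (simp add: power2_norm_eq_inner inner_diff_left inner_diff_right inner_add_left
        inner_add_right inner_commute)
  then show ?thesis
    using zero_le_power2[of "norm (x - y)"] by linarith
qed

text \<open>The direct sum of countably many copies of a space: one vector of it encodes a
  square-summable sequence. Only the real structure is built; complex linearity is recovered where
  it is needed.\<close>

typedef (overloaded) 'a ell2 = "{f :: nat \<Rightarrow> 'a::real_inner. summable (\<lambda>n. (norm (f n))\<^sup>2)}"
  morphisms ell2_nth Ell2
  by (rule exI[of _ "\<lambda>_. 0"]) simp

lemma summable_ell2: "summable (\<lambda>n. (norm (ell2_nth v n))\<^sup>2)"
  using ell2_nth[of v] by simp

lemma ell2_eqI: "(\<And>n. ell2_nth v n = ell2_nth w n) \<Longrightarrow> v = w"
  by (metis ell2_nth_inject ext)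

lemma summable_inner:
  assumes "summable (\<lambda>n. (norm (f n))\<^sup>2)" "summable (\<lambda>n. (norm (g n))\<^sup>2)"
  shows "summable (\<lambda>n. norm (f n) * norm (g n))" "summable (\<lambda>n. inner (f n) (g n))"
proof -
  show *: "summable (\<lambda>n. norm (f n) * norm (g n))"
  proof (rule summable_comparison_test'[OF summable_add[OF assms], of 0])
    show "norm (norm (f n) * norm (g n)) \<le> (norm (f n))\<^sup>2 + (norm (g n))\<^sup>2" for n
    proof -
      have "0 \<le> norm (f n) * norm (g n)"
        by simp
      moreover have "2 * (norm (f n) * norm (g n)) \<le> (norm (f n))\<^sup>2 + (norm (g n))\<^sup>2"
        using sum_squares_bound[of "norm (f n)" "norm (g n)"] by (simp add: mult.assoc)
      ultimately show ?thesis
        by (simp only: real_norm_def abs_mult abs_norm_cancel)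
    qed
  qed
  show "summable (\<lambda>n. inner (f n) (g n))"
    by (rule summable_comparison_test'[OF *, of 0]) (simp add: Cauchy_Schwarz_ineq2)
qed

lemma summable_norm_add_power2:
  assumes "summable (\<lambda>n. (norm (f n))\<^sup>2)" "summable (\<lambda>n. (norm (g n :: 'a::real_inner))\<^sup>2)"
  shows "summable (\<lambda>n. (norm (f n + g n))\<^sup>2)"
  by (rule summable_comparison_test'[of "\<lambda>n. 2 * (norm (f n))\<^sup>2 + 2 * (norm (g n))\<^sup>2" 0])
    (auto intro!: summable_add summable_mult assms norm_add_power2_le)

instantiation ell2 :: (real_inner) real_inner
begin

definition "0 = Ell2 (\<lambda>_. 0)"
definition "v + w = Ell2 (\<lambda>n. ell2_nth v n + ell2_nth w n)"
definition "- v = Ell2 (\<lambda>n. - ell2_nth v n)"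
definition "v - w = Ell2 (\<lambda>n. ell2_nth v n - ell2_nth w n)"
definition "r *\<^sub>R v = Ell2 (\<lambda>n. r *\<^sub>R ell2_nth v n)"
definition "inner v w = (\<Sum>n. inner (ell2_nth v n) (ell2_nth w n))"
definition "norm (v::'a ell2) = sqrt (inner v v)"
definition "sgn (v::'a ell2) = inverse (norm v) *\<^sub>R v"
definition "dist v w = norm (v - w :: 'a ell2)"
definition "(uniformity :: ('a ell2 \<times> 'a ell2) filter) = (INF e\<in>{0<..}. principal {(x, y). dist x y < e})"
definition "open (U :: 'a ell2 set) =
  (\<forall>x\<in>U. eventually (\<lambda>(x', y). x' = x \<longrightarrow> y \<in> U) uniformity)"

lemma ell2_nth_simps [simp]:
  "ell2_nth (0::'a ell2) n = 0" "ell2_nth (v + w) n = ell2_nth v n + ell2_nth w n"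
  "ell2_nth (- v) n = - ell2_nth v n" "ell2_nth (v - w) n = ell2_nth v n - ell2_nth w n"
  "ell2_nth (r *\<^sub>R v) n = r *\<^sub>R ell2_nth v n"
  using summable_norm_add_power2[OF summable_ell2[of v] summable_ell2[of w]]
    summable_norm_add_power2[OF summable_ell2[of v], of "\<lambda>n. - ell2_nth w n"]
    summable_mult[OF summable_ell2[of v], of "r\<^sup>2"]
  by (simp_all add: zero_ell2_def plus_ell2_def uminus_ell2_def minus_ell2_def scaleR_ell2_def
      Ell2_inverse summable_ell2 power_mult_distrib)

instance
proof
  fix u v w :: "'a ell2" and a b :: real
  note sums = summable_inner(2)[OF summable_ell2 summable_ell2]
  show "inner v w = inner w v"
    by (simp add: inner_ell2_def inner_commute)
  show "inner (u + v) w = inner u w + inner v w"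
    by (simp add: inner_ell2_def inner_add_left suminf_add sums)
  show "inner (a *\<^sub>R v) w = a * inner v w"
    by (simp add: inner_ell2_def suminf_mult sums)
  show "0 \<le> inner v v"
    by (simp add: inner_ell2_def suminf_nonneg sums)
  show "inner v v = 0 \<longleftrightarrow> v = 0"
    using suminf_eq_zero_iff[OF sums, of v v] by (auto simp: inner_ell2_def intro: ell2_eqI)
qed (auto intro!: ell2_eqI simp: algebra_simps sgn_ell2_def dist_ell2_def uniformity_ell2_def
    open_ell2_def norm_ell2_def)

end

lemma norm_ell2_power2: "(norm v)\<^sup>2 = (\<Sum>n. (norm (ell2_nth v n))\<^sup>2)"
  by (simp only: power2_norm_eq_inner inner_ell2_def)

lemma norm_ell2_nth_le: "norm (ell2_nth v n) \<le> norm v"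
proof (rule power2_le_imp_le)
  show "(norm (ell2_nth v n))\<^sup>2 \<le> (norm v)\<^sup>2"
    using sum_le_suminf[OF summable_ell2[of v], of "{n}"] by (simp add: norm_ell2_power2)
qed simp

lemma bounded_linear_ell2_nth: "bounded_linear (\<lambda>v. ell2_nth v n)"
  by (rule bounded_linear_intro[where K = 1]) (auto intro: norm_ell2_nth_le)

instance ell2 :: ("{real_inner, complete_space}") complete_space
proof
  fix X :: "nat \<Rightarrow> 'a ell2"
  assume X: "Cauchy X"
  have "Cauchy (\<lambda>m. ell2_nth (X m) n)" for n
    by (rule bounded_linear.Cauchy[OF bounded_linear_ell2_nth X])
  then have "\<exists>y. (\<lambda>m. ell2_nth (X m) n) \<longlonglongrightarrow> y" for n
    using Cauchy_convergent convergent_def by blast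
  then obtain f where f: "\<And>n. (\<lambda>m. ell2_nth (X m) n) \<longlonglongrightarrow> f n"
    by metis
  \<comment> \<open>The bound on partial sums is uniform in N, so the limit in the second index can
    be taken for finite sums before N grows.\<close>
  have tail: "\<exists>k. \<forall>m\<ge>k. \<forall>N. (\<Sum>n<N. (norm (ell2_nth (X m) n - f n))\<^sup>2) \<le> e\<^sup>2" if e: "0 < e" for e
  proof -
    obtain k where k: "\<And>m l. m \<ge> k \<Longrightarrow> l \<ge> k \<Longrightarrow> norm (X m - X l) < e"
      using CauchyD[OF X e] by blast
    have "(\<Sum>n<N. (norm (ell2_nth (X m) n - f n))\<^sup>2) \<le> e\<^sup>2" if m: "m \<ge> k" for m N
    proof (rule tendsto_upperbound)
      show "(\<lambda>l. \<Sum>n<N. (norm (ell2_nth (X m) n - ell2_nth (X l) n))\<^sup>2)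
          \<longlonglongrightarrow> (\<Sum>n<N. (norm (ell2_nth (X m) n - f n))\<^sup>2)"
        by (intro tendsto_intros f)
      have "(\<Sum>n<N. (norm (ell2_nth (X m) n - ell2_nth (X l) n))\<^sup>2) \<le> e\<^sup>2" if l: "l \<ge> k" for l
      proof -
        have "(\<Sum>n<N. (norm (ell2_nth (X m - X l) n))\<^sup>2) \<le> (norm (X m - X l))\<^sup>2"
          unfolding norm_ell2_power2 by (rule sum_le_suminf[OF summable_ell2]) auto
        also have "\<dots> \<le> e\<^sup>2"
          using k[OF m l] by (simp add: power_mono)
        finally show ?thesis
          by simp
      qed
      then show "\<forall>\<^sub>F l in sequentially. (\<Sum>n<N. (norm (ell2_nth (X m) n - ell2_nth (X l) n))\<^sup>2) \<le> e\<^sup>2"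
        by (auto simp: eventually_sequentially)
    qed simp
    then show ?thesis
      by blast
  qed
  have diff: "summable (\<lambda>n. (norm (ell2_nth (X m) n - f n))\<^sup>2)"
    if "\<forall>N. (\<Sum>n<N. (norm (ell2_nth (X m) n - f n))\<^sup>2) \<le> e\<^sup>2" for m e
    using that by (intro summableI_nonneg_bounded[of _ "e\<^sup>2"]) auto
  obtain k1 where k1: "\<forall>m\<ge>k1. \<forall>N. (\<Sum>n<N. (norm (ell2_nth (X m) n - f n))\<^sup>2) \<le> 1\<^sup>2"
    using tail[of 1] by auto
  \<comment> \<open>The coordinatewise limit is itself square-summable, being a square-summable
    difference plus one member of the sequence.\<close>
  have "summable (\<lambda>n. (norm (f n - ell2_nth (X k1) n + ell2_nth (X k1) n))\<^sup>2)"
    using diff[of k1 1] k1 summable_ell2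
    by (intro summable_norm_add_power2) (auto simp: norm_minus_commute)
  then have nth: "ell2_nth (Ell2 f) n = f n" for n
    by (simp add: Ell2_inverse)
  have "X \<longlonglongrightarrow> Ell2 f"
  proof (rule LIMSEQ_I)
    fix e :: real
    assume "0 < e"
    then obtain k where k: "\<forall>m\<ge>k. \<forall>N. (\<Sum>n<N. (norm (ell2_nth (X m) n - f n))\<^sup>2) \<le> (e/2)\<^sup>2"
      using tail[of "e/2"] by auto
    have "norm (X m - Ell2 f) < e" if "m \<ge> k" for m
    proof -
      have "(norm (X m - Ell2 f))\<^sup>2 \<le> (e/2)\<^sup>2"
        using k that diff[of m "e/2"] by (simp add: norm_ell2_power2 nth suminf_le_const)
      then have "norm (X m - Ell2 f) \<le> e/2"
        using \<open>0 < e\<close> by (auto intro: power2_le_imp_le)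
      then show ?thesis
        using \<open>0 < e\<close> by simp
    qed
    then show "\<exists>k. \<forall>m\<ge>k. norm (X m - Ell2 f) < e"
      by blast
  qed
  then show "convergent X"
    by (auto simp: convergent_def)
qed

lemma summable_mult_sqrt_le:
  fixes a b :: "nat \<Rightarrow> real"
  assumes "summable (\<lambda>n. (a n)\<^sup>2)" "summable (\<lambda>n. (b n)\<^sup>2)"
  shows "(\<Sum>n. a n * b n) \<le> sqrt (\<Sum>n. (a n)\<^sup>2) * sqrt (\<Sum>n. (b n)\<^sup>2)"
  using norm_cauchy_schwarz[of "Ell2 a" "Ell2 b"] assms
  by (simp add: inner_ell2_def norm_ell2_def Ell2_inverse power2_eq_square)

definition ell2_single :: "nat \<Rightarrow> 'a::real_inner \<Rightarrow> 'a ell2"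
  where "ell2_single j x = Ell2 (\<lambda>n. if n = j then x else 0)"

lemma ell2_nth_single [simp]: "ell2_nth (ell2_single j x) n = (if n = j then x else 0)"
proof -
  have "summable (\<lambda>n. (norm (if n = j then x else 0))\<^sup>2)"
    by (rule summable_finite[of "{j}"]) auto
  then show ?thesis
    by (simp add: ell2_single_def Ell2_inverse)
qed

lemma norm_ell2_single [simp]: "norm (ell2_single j x) = norm x"
proof -
  have "(norm (ell2_single j x))\<^sup>2 = (norm x)\<^sup>2"
    using suminf_finite[of "{j}" "\<lambda>n. (norm (if n = j then x else 0))\<^sup>2"]
    by (simp add: norm_ell2_power2)
  then show ?thesis
    by (simp add: power2_eq_iff_nonneg)
qed

lemma bounded_linear_ell2_single: "bounded_linear (ell2_single j)"
  by (rule bounded_linear_intro[where K = 1]) (auto intro!: ell2_eqI)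

lemma ell2_single_sums: "(\<lambda>j. ell2_single j (ell2_nth v j)) sums v"
  unfolding sums_def
proof (rule LIMSEQ_I)
  fix e :: real
  assume e: "0 < e"
  have nth: "ell2_nth (\<Sum>j<m. ell2_single j (ell2_nth v j)) n = (if n < m then ell2_nth v n else 0)"
    for m n
    using linear_sum[OF bounded_linear.linear[OF bounded_linear_ell2_nth], of "\<lambda>j. ell2_single j (ell2_nth v j)" "{..<m}" n]
    by (simp add: if_distrib cong: if_cong)
  have "\<exists>M. \<forall>m\<ge>M. norm (\<Sum>n. (norm (ell2_nth v (n + m)))\<^sup>2) < e\<^sup>2"
    using suminf_exist_split[OF zero_less_power[OF e, of 2] summable_ell2[of v]] by auto
  then obtain M where M: "\<And>m. m \<ge> M \<Longrightarrow> norm (\<Sum>n. (norm (ell2_nth v (n + m)))\<^sup>2) < e\<^sup>2"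
    by blast
  have "norm ((\<Sum>j<m. ell2_single j (ell2_nth v j)) - v) < e" if "m \<ge> M" for m
  proof -
    let ?d = "(\<Sum>j<m. ell2_single j (ell2_nth v j)) - v"
    have "(norm ?d)\<^sup>2 = (\<Sum>n. (norm (ell2_nth ?d (n + m)))\<^sup>2)"
      using suminf_split_initial_segment[OF summable_ell2[of ?d], of m]
      by (simp add: norm_ell2_power2 nth)
    also have "\<dots> = (\<Sum>n. (norm (ell2_nth v (n + m)))\<^sup>2)"
      by (simp add: nth)
    also have "\<dots> < e\<^sup>2"
      using M[OF that] by simp
    finally show ?thesis
      using e by (auto intro: power2_less_imp_less)
  qed
  then show "\<exists>M. \<forall>m\<ge>M. norm ((\<Sum>j<m. ell2_single j (ell2_nth v j)) - v) < e"
    by blast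
qed

text \<open>Vectors with a single nonzero coordinate span a dense subspace, so operators on the
  direct sum can be compared entry by entry.\<close>

lemma blinfun_ell2_eqI:
  fixes F G :: "'a::real_inner ell2 \<Rightarrow>\<^sub>L 'b::real_normed_vector"
  assumes "\<And>j x. F (ell2_single j x) = G (ell2_single j x)"
  shows "F = G"
proof (rule blinfun_eqI)
  fix v
  have "(\<lambda>j. F (ell2_single j (ell2_nth v j))) sums F v"
    "(\<lambda>j. G (ell2_single j (ell2_nth v j))) sums G v"
    by (intro bounded_linear.sums[OF blinfun.bounded_linear_right] ell2_single_sums)+
  then show "F v = G v"
    using assms sums_unique2 by simp
qed

lemma ell2_diag_exists:
  fixes T :: "'a::real_inner \<Rightarrow>\<^sub>L 'a"
  shows "\<exists>D :: 'a ell2 \<Rightarrow>\<^sub>L 'a ell2. \<forall>v n. ell2_nth (D v) n = T (ell2_nth v n)"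
proof -
  have le: "(norm (T (ell2_nth v n)))\<^sup>2 \<le> (norm T)\<^sup>2 * (norm (ell2_nth v n))\<^sup>2" for v n
    by (metis norm_blinfun norm_ge_zero power_mono power_mult_distrib)
  have sm: "summable (\<lambda>n. (norm T)\<^sup>2 * (norm (ell2_nth v n))\<^sup>2)" for v :: "'a ell2"
    by (intro summable_mult summable_ell2)
  have s: "summable (\<lambda>n. (norm (T (ell2_nth v n)))\<^sup>2)" for v
    by (rule summable_comparison_test'[OF sm[of v], of 0]) (simp add: le)
  define D where "D v = Ell2 (\<lambda>n. T (ell2_nth v n))" for v
  have nth: "ell2_nth (D v) n = T (ell2_nth v n)" for v n
    by (simp add: D_def Ell2_inverse s)
  have "bounded_linear D"
  proof (rule bounded_linear_intro[where K = "norm T"])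
    show "norm (D v) \<le> norm v * norm T" for v
    proof (rule power2_le_imp_le)
      have "(norm (D v))\<^sup>2 \<le> (\<Sum>n. (norm T)\<^sup>2 * (norm (ell2_nth v n))\<^sup>2)"
        unfolding norm_ell2_power2 nth by (rule suminf_le[OF le s sm])
      then show "(norm (D v))\<^sup>2 \<le> (norm v * norm T)\<^sup>2"
        by (simp add: suminf_mult[OF summable_ell2] norm_ell2_power2[symmetric] power_mult_distrib
            mult.commute)
    qed simp
  qed (auto intro!: ell2_eqI simp: nth blinfun.bilinear_simps)
  then show ?thesis
    using nth by (intro exI[of _ "Blinfun D"]) (simp add: bounded_linear_Blinfun_apply)
qed

text \<open>The amplification of T, usually written T \<otimes> 1: the block-diagonal operator with
  T in every entry.\<close>

definition ell2_diag :: "('a::real_inner \<Rightarrow>\<^sub>L 'a) \<Rightarrow> 'a ell2 \<Rightarrow>\<^sub>L 'a ell2"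
  where "ell2_diag T = (SOME D. \<forall>v n. ell2_nth (blinfun_apply D v) n = T (ell2_nth v n))"

lemma ell2_nth_diag [simp]: "ell2_nth (blinfun_apply (ell2_diag T) v) n = T (ell2_nth v n)"
  unfolding ell2_diag_def using someI_ex[OF ell2_diag_exists[of T]] by blast

section \<open>The bicommutant theorem\<close>

text \<open>Isolates the algebraic closure properties, so that they can be used for the fixed points
  before these are known to equal their bicommutant.\<close>

definition star_algebra :: "('h::chilbert_space) op set \<Rightarrow> bool"
  where "star_algebra A \<longleftrightarrow> A \<subseteq> bounded_ops \<and> id_blinfun \<in> A \<and>
    (\<forall>x\<in>A. op_adj x \<in> A) \<and> (\<forall>x\<in>A. \<forall>y\<in>A. x + y \<in> A \<and> x o\<^sub>L y \<in> A) \<and>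
    (\<forall>x\<in>A. \<forall>c. op_scaleC c x \<in> A)"

lemma
  assumes "star_algebra A"
  shows star_algebra_bounded: "x \<in> A \<Longrightarrow> x \<in> bounded_ops"
    and star_algebra_id: "id_blinfun \<in> A"
    and star_algebra_adj: "x \<in> A \<Longrightarrow> op_adj x \<in> A"
    and star_algebra_add: "x \<in> A \<Longrightarrow> y \<in> A \<Longrightarrow> x + y \<in> A"
    and star_algebra_compose: "x \<in> A \<Longrightarrow> y \<in> A \<Longrightarrow> x o\<^sub>L y \<in> A"
    and star_algebra_scaleC: "x \<in> A \<Longrightarrow> op_scaleC c x \<in> A"
    and star_algebra_scaleR: "x \<in> A \<Longrightarrow> r *\<^sub>R x \<in> A"
    and star_algebra_diff: "x \<in> A \<Longrightarrow> y \<in> A \<Longrightarrow> x - y \<in> A"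
proof -
  show *: "x \<in> A \<Longrightarrow> x \<in> bounded_ops" "id_blinfun \<in> A" "x \<in> A \<Longrightarrow> op_adj x \<in> A"
    "x \<in> A \<Longrightarrow> y \<in> A \<Longrightarrow> x + y \<in> A" "x \<in> A \<Longrightarrow> y \<in> A \<Longrightarrow> x o\<^sub>L y \<in> A"
    "x \<in> A \<Longrightarrow> op_scaleC c x \<in> A" for x y c
    using assms by (auto simp: star_algebra_def)
  show "r *\<^sub>R x \<in> A" if "x \<in> A" for x
    using *(6)[OF that, of "of_real r"] by (simp add: op_scaleC_of_real)
  have m: "- x \<in> A" if "x \<in> A" for x
    using *(6)[OF that, of "-1"] by (simp add: op_scaleC_minus_one)
  show "x - y \<in> A" if "x \<in> A" "y \<in> A"
    using *(4)[OF that(1) m[OF that(2)]] by simp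
qed

lemma subspace_closure:
  fixes S :: "'a::real_normed_vector set"
  assumes "subspace S"
  shows "subspace (closure S)"
  unfolding subspace_def
proof (intro conjI ballI allI)
  show "0 \<in> closure S"
    using subspace_0[OF assms] closure_subset by blast
next
  fix x y
  assume "x \<in> closure S" "y \<in> closure S"
  then obtain u v where "\<And>n. u n \<in> S" "u \<longlonglongrightarrow> x" "\<And>n. v n \<in> S" "v \<longlonglongrightarrow> y"
    by (metis closure_sequential)
  then show "x + y \<in> closure S"
    unfolding closure_sequential
    by (intro exI[of _ "\<lambda>n. u n + v n"]) (auto intro: tendsto_add subspace_add[OF assms])
next
  fix x c
  assume "x \<in> closure S"
  then obtain u where "\<And>n. u n \<in> S" "u \<longlonglongrightarrow> x"
    by (metis closure_sequential)
  then show "c *\<^sub>R x \<in> closure S"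
    unfolding closure_sequential
    by (intro exI[of _ "\<lambda>n. c *\<^sub>R u n"]) (auto intro: tendsto_intros subspace_scale[OF assms])
qed

text \<open>A subspace invariant under A and under its adjoint is reducing: A maps the orthogonal
  complement of X into itself as well.\<close>

lemma orthogonal_projection_commutes:
  fixes \<pi> A B :: "'a::real_inner \<Rightarrow>\<^sub>L 'a"
  assumes \<pi>: "subspace X" "\<And>x. \<pi> x \<in> X" "\<And>x z. z \<in> X \<Longrightarrow> inner (x - \<pi> x) z = 0"
    and adj: "\<And>x y. inner (A x) y = inner x (B y)"
    and inv: "\<And>x. x \<in> X \<Longrightarrow> A x \<in> X" "\<And>x. x \<in> X \<Longrightarrow> B x \<in> X"
  shows "A (\<pi> x) = \<pi> (A x)"
proof -
  define d where "d = A (\<pi> x) - \<pi> (A x)"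
  have d: "d \<in> X"
    using \<pi> inv by (simp add: d_def subspace_diff)
  have "inner (A x - A (\<pi> x)) d = 0"
    using \<pi>(3)[OF inv(2)[OF d], of x] by (simp add: adj flip: blinfun.diff_right)
  moreover have "inner (A x - \<pi> (A x)) d = 0"
    using \<pi>(3)[OF d] by blast
  ultimately have "inner d d = 0"
    by (simp add: d_def inner_diff_left)
  then show ?thesis
    by (simp add: d_def)
qed

text \<open>Von Neumann's argument on the amplified space. The projection onto the closure of the
  orbit of \<zeta> commutes with the amplification of P, so its matrix entries lie in the commutant
  of P and hence commute with T. The amplified T therefore preserves the closed orbit, which
  contains \<zeta>.\<close>

lemma star_algebra_bicommutant_approx:
  assumes P: "star_algebra P" and T: "T \<in> commutant (commutant P)"
    and \<zeta>: "square_summable \<zeta>" and e: "0 < e"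
  obtains x where "x \<in> P" "(\<Sum>n. (norm (blinfun_apply (x - T) (\<zeta> n)))\<^sup>2) < e"
proof -
  define z where "z = Ell2 \<zeta>"
  have nth_z: "ell2_nth z n = \<zeta> n" for n
    using \<zeta> by (simp add: z_def Ell2_inverse square_summable_def)
  define X0 where "X0 = (\<lambda>x. ell2_diag x z) ` P"
  define X where "X = closure X0"
  have "subspace X0"
    unfolding subspace_def X0_def
  proof (intro conjI ballI allI; clarsimp?)
    show "0 \<in> (\<lambda>x. ell2_diag x z) ` P"
      using star_algebra_scaleR[OF P star_algebra_id[OF P], of 0]
      by (intro image_eqI[of _ _ "0 *\<^sub>R id_blinfun"]) (auto intro!: ell2_eqI)
    show "ell2_diag x z + ell2_diag y z \<in> (\<lambda>x. ell2_diag x z) ` P" if "x \<in> P" "y \<in> P" for x y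
      using star_algebra_add[OF P that] by (intro image_eqI[of _ _ "x + y"]) (auto intro!: ell2_eqI)
    show "c *\<^sub>R ell2_diag x z \<in> (\<lambda>x. ell2_diag x z) ` P" if "x \<in> P" for x c
      using star_algebra_scaleR[OF P that] by (intro image_eqI[of _ _ "c *\<^sub>R x"]) (auto intro!: ell2_eqI)
  qed
  then have subX: "subspace X"
    unfolding X_def by (rule subspace_closure)
  obtain \<pi> where \<pi>: "\<And>v. blinfun_apply \<pi> v \<in> X" "\<And>v w. w \<in> X \<Longrightarrow> inner (v - \<pi> v) w = 0"
    using orthogonal_projection_blinfun[OF subX] by (auto simp: X_def)
  have invX: "ell2_diag a v \<in> X" if a: "a \<in> P" and v: "v \<in> X" for a v
  proof -
    have "ell2_diag a ` closure X0 \<subseteq> X"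
    proof (rule image_closure_subset)
      show "ell2_diag a ` X0 \<subseteq> X"
      proof
        fix w
        assume "w \<in> ell2_diag a ` X0"
        then obtain x where x: "x \<in> P" "w = ell2_diag a (ell2_diag x z)"
          by (auto simp: X0_def)
        then have "w = ell2_diag (a o\<^sub>L x) z"
          by (auto intro!: ell2_eqI)
        then have "w \<in> X0"
          using star_algebra_compose[OF P a x(1)] by (simp add: X0_def)
        then show "w \<in> X"
          using closure_subset by (auto simp: X_def)
      qed
    qed (auto simp: X_def intro: linear_continuous_on blinfun.bounded_linear_right)
    then show ?thesis
      using v by (auto simp: X_def)
  qed
  have comm: "ell2_diag a (\<pi> v) = \<pi> (ell2_diag a v)" if a: "a \<in> P" for a v
  proof (rule orthogonal_projection_commutes[where B = "ell2_diag (op_adj a)", OF subX \<pi>])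
    show "inner (ell2_diag a v) w = inner v (ell2_diag (op_adj a) w)" for v w
      using op_adj_right[OF star_algebra_bounded[OF P a]]
      by (simp add: inner_ell2_def inner_eq_Re_cinner)
  qed (use invX a star_algebra_adj[OF P a] in auto)
  \<comment> \<open>The matrix entries of \<pi> as operators on the original space.\<close>
  define p where "p i j = Blinfun (\<lambda>x. ell2_nth (\<pi> (ell2_single j x)) i)" for i j
  have p: "p i j x = ell2_nth (\<pi> (ell2_single j x)) i" for i j x
    unfolding p_def
    by (rule bounded_linear_Blinfun_apply[THEN fun_cong])
      (intro bounded_linear_compose[OF bounded_linear_ell2_nth]
        bounded_linear_compose[OF blinfun.bounded_linear_right] bounded_linear_ell2_single)
  have pa: "p i j (a x) = a (p i j x)" if a: "a \<in> P" for i j a x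
  proof -
    have "ell2_single j (a x) = ell2_diag a (ell2_single j x)"
      by (auto intro!: ell2_eqI)
    then show ?thesis
      by (simp add: p flip: comm[OF a])
  qed
  have "p i j \<in> commutant P" for i j
  proof -
    \<comment> \<open>\<pi> was constructed as a real-linear projection; its entries are
      complex-linear because the scalar multiples of the identity belong to P.\<close>
    have "p i j (c *\<^sub>C x) = c *\<^sub>C p i j x" for c x
      using pa[OF star_algebra_scaleC[OF P star_algebra_id[OF P]]] by simp
    then show ?thesis
      using pa by (auto simp: commutant_def bounded_ops_def intro!: blinfun_eqI)
  qed
  then have "T o\<^sub>L p i j = p i j o\<^sub>L T" for i j
    using T by (auto simp: commutant_def)
  then have Tp: "T (p i j x) = p i j (T x)" for i j x
    by (metis blinfun_apply_blinfun_compose)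
  have "ell2_diag T o\<^sub>L \<pi> = \<pi> o\<^sub>L ell2_diag T"
  proof (rule blinfun_ell2_eqI)
    fix j x
    have "ell2_single j (T x) = ell2_diag T (ell2_single j x)"
      by (auto intro!: ell2_eqI)
    then show "(ell2_diag T o\<^sub>L \<pi>) (ell2_single j x) = (\<pi> o\<^sub>L ell2_diag T) (ell2_single j x)"
      using Tp[of _ j x] by (intro ell2_eqI) (simp add: p)
  qed
  then have "ell2_diag T (\<pi> z) = \<pi> (ell2_diag T z)"
    by (metis blinfun_apply_blinfun_compose)
  moreover have "\<pi> z = z"
  proof -
    have "z \<in> X0"
      unfolding X0_def
      by (rule image_eqI[of _ _ id_blinfun]) (auto intro!: ell2_eqI star_algebra_id[OF P])
    then have "z \<in> X"
      using closure_subset by (auto simp: X_def)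
    then have "inner (z - \<pi> z) (z - \<pi> z) = 0"
      using \<pi> subX by (simp add: subspace_diff)
    then show ?thesis
      by simp
  qed
  ultimately have "ell2_diag T z \<in> closure X0"
    using \<pi>(1)[of "ell2_diag T z"] by (simp add: X_def)
  then obtain w where "w \<in> X0" "dist w (ell2_diag T z) < sqrt e"
    using e by (meson closure_approachable real_sqrt_gt_zero)
  then obtain x where x: "x \<in> P" "norm (ell2_diag x z - ell2_diag T z) < sqrt e"
    by (auto simp: X0_def dist_norm)
  have "(norm (ell2_diag x z - ell2_diag T z))\<^sup>2 < (sqrt e)\<^sup>2"
    using x(2) by (intro power_strict_mono) auto
  then have "(\<Sum>n. (norm ((x - T) (\<zeta> n)))\<^sup>2) < e"
    using e by (simp add: norm_ell2_power2 nth_z)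
  then show ?thesis
    using that x by blast
qed

section \<open>Ultraweak neighbourhoods and ultraweak density\<close>

lemma square_summable_blinfun:
  assumes "square_summable \<xi>"
  shows "square_summable (\<lambda>n. blinfun_apply (T::('h::chilbert_space) op) (\<xi> n))"
  using summable_ell2[of "ell2_diag T (Ell2 \<xi>)"] assms
  by (simp add: square_summable_def Ell2_inverse)

lemma summable_cinner:
  assumes "square_summable \<xi>" "square_summable \<eta>"
  shows "summable (\<lambda>n. cinner (\<xi> n) (\<eta> n))"
proof (rule summable_comparison_test'[of _ 0])
  show "summable (\<lambda>n. norm (\<xi> n) * norm (\<eta> n))"
    using summable_inner(1) assms by (auto simp: square_summable_def)
qed (rule norm_cinner_le)

lemma norm_suminf_cinner_le:
  assumes "square_summable \<xi>" "square_summable \<eta>"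
  shows "cmod (\<Sum>n. cinner (\<xi> n) (\<eta> n))
    \<le> sqrt (\<Sum>n. (norm (\<xi> n))\<^sup>2) * sqrt (\<Sum>n. (norm (\<eta> n))\<^sup>2)"
proof -
  have s: "summable (\<lambda>n. norm (\<xi> n) * norm (\<eta> n))"
    using summable_inner(1) assms by (auto simp: square_summable_def)
  have "cmod (\<Sum>n. cinner (\<xi> n) (\<eta> n)) \<le> (\<Sum>n. norm (\<xi> n) * norm (\<eta> n))"
    by (rule norm_suminf_le[OF norm_cinner_le s])
  also have "\<dots> \<le> sqrt (\<Sum>n. (norm (\<xi> n))\<^sup>2) * sqrt (\<Sum>n. (norm (\<eta> n))\<^sup>2)"
    by (rule summable_mult_sqrt_le) (use assms in \<open>auto simp: square_summable_def\<close>)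
  finally show ?thesis .
qed

text \<open>Every ultraweak neighbourhood contains an ultrastrong one governed by a single sequence,
  which is the form of approximation that the bicommutant argument delivers.\<close>

lemma ultraweak_neighbourhood:
  assumes "openin ultraweak_topology W" "T \<in> W"
  shows "\<exists>\<zeta> e. square_summable \<zeta> \<and> 0 < e \<and>
    (\<forall>x. (\<Sum>n. (norm (blinfun_apply (x - T) (\<zeta> n)))\<^sup>2) < e \<longrightarrow> x \<in> W)"
  using openin_topology_generated_by[OF assms(1)[unfolded ultraweak_topology_def]] assms(2)
proof (induction rule: generate_topology_on.induct)
  case Empty
  then show ?case by simp
next
  case (UN K)
  then show ?case by (meson UnionE UnionI)
next
  \<comment> \<open>a single sequence suffices for both neighbourhoods: interleave\<close>
  case (Int a b)
  obtain \<zeta> e where 1: "square_summable \<zeta>" "0 < e"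
    "\<And>x. (\<Sum>n. (norm ((x - T) (\<zeta> n)))\<^sup>2) < e \<Longrightarrow> x \<in> a"
    using Int by auto
  obtain \<eta> d where 2: "square_summable \<eta>" "0 < d"
    "\<And>x. (\<Sum>n. (norm ((x - T) (\<eta> n)))\<^sup>2) < d \<Longrightarrow> x \<in> b"
    using Int by auto
  define \<theta> where "\<theta> n = (if even n then \<zeta> (n div 2) else \<eta> ((n - 1) div 2))" for n
  have sums: "(\<lambda>n. (norm (S (\<theta> n)))\<^sup>2)
      sums ((\<Sum>n. (norm (S (\<eta> n)))\<^sup>2) + (\<Sum>n. (norm (S (\<zeta> n)))\<^sup>2))" for S :: "'a op"
    using sums_if[OF summable_sums summable_sums, OF
        square_summable_blinfun[OF 2(1), of S, unfolded square_summable_def]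
        square_summable_blinfun[OF 1(1), of S, unfolded square_summable_def]]
    unfolding \<theta>_def by (rule sums_cong[THEN iffD1, rotated]) simp
  have "square_summable \<theta>"
    using sums_summable[OF sums[of id_blinfun]] by (simp add: square_summable_def)
  moreover have "x \<in> a \<inter> b" if "(\<Sum>n. (norm ((x - T) (\<theta> n)))\<^sup>2) < min e d" for x
  proof -
    have "(\<Sum>n. (norm ((x - T) (\<theta> n)))\<^sup>2)
        = (\<Sum>n. (norm ((x - T) (\<eta> n)))\<^sup>2) + (\<Sum>n. (norm ((x - T) (\<zeta> n)))\<^sup>2)"
      using sums_unique[OF sums[of "x - T"]] by simp
    moreover have "0 \<le> (\<Sum>n. (norm ((x - T) (\<eta> n)))\<^sup>2)" "0 \<le> (\<Sum>n. (norm ((x - T) (\<zeta> n)))\<^sup>2)"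
      using square_summable_blinfun[OF 2(1), of "x - T"] square_summable_blinfun[OF 1(1), of "x - T"]
      by (auto intro!: suminf_nonneg simp del: op_apply_simps simp: square_summable_def)
    ultimately show ?thesis
      using that by (intro IntI 1(3) 2(3)) linarith+
  qed
  ultimately show ?case
    using 1(2) 2(2) by (intro exI[of _ \<theta>] exI[of _ "min e d"]) auto
next
  case (Basis s)
  then obtain \<xi> \<eta> U where s: "s = {T. (\<Sum>n. cinner (blinfun_apply T (\<xi> n)) (\<eta> n)) \<in> U}"
    and sq: "square_summable \<xi>" "square_summable \<eta>" and U: "open U"
    by auto
  let ?f = "\<lambda>T. \<Sum>n. cinner (blinfun_apply T (\<xi> n)) (\<eta> n)"
  obtain r where r: "0 < r" "\<And>z. dist z (?f T) < r \<Longrightarrow> z \<in> U"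
    using U Basis(2) s by (auto simp: open_dist)
  define C where "C = sqrt (\<Sum>n. (norm (\<eta> n))\<^sup>2)"
  have C: "0 \<le> C"
    using sq by (auto simp: C_def square_summable_def intro!: suminf_nonneg)
  \<comment> \<open>Chosen so that \<open>sqrt e * C\<close> equals r C / (C + 1), which is strictly
    below r; adding 1 also covers C = 0.\<close>
  define e where "e = (r / (C + 1))\<^sup>2"
  have "x \<in> s" if "(\<Sum>n. (norm ((x - T) (\<xi> n)))\<^sup>2) < e" for x
  proof -
    have "?f x - ?f T = (\<Sum>n. cinner ((x - T) (\<xi> n)) (\<eta> n))"
      using suminf_diff[OF summable_cinner summable_cinner, OF square_summable_blinfun[OF sq(1)] sq(2)
          square_summable_blinfun[OF sq(1)] sq(2), of x T]
      by (simp add: cinner_diff_left)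
    then have "dist (?f x) (?f T) \<le> sqrt (\<Sum>n. (norm ((x - T) (\<xi> n)))\<^sup>2) * C"
      using norm_suminf_cinner_le[OF square_summable_blinfun[OF sq(1), of "x - T"] sq(2)]
      by (simp add: dist_norm C_def)
    also have "\<dots> \<le> sqrt e * C"
      using that C by (intro mult_right_mono) auto
    also have "\<dots> = r * (C / (C + 1))"
      using r C by (simp add: e_def)
    also have "\<dots> < r * 1"
      using r C by (intro mult_strict_left_mono) auto
    finally show ?thesis
      using r(2) by (simp add: s)
  qed
  moreover have "0 < e"
    using r C by (simp add: e_def)
  ultimately show ?case
    using sq(1) by (intro exI[of _ \<xi>] exI[of _ e]) auto
qed

lemma star_algebra_ultraweakly_dense:
  assumes "star_algebra P" "T \<in> commutant (commutant P)"
    and "openin ultraweak_topology W" "T \<in> W"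
  obtains x where "x \<in> P" "x \<in> W"
  using ultraweak_neighbourhood[OF assms(3,4)] star_algebra_bicommutant_approx[OF assms(1,2)] that
  by metis

section \<open>Von Neumann algebras and their traces\<close>

lemma op_scaleC_minus: "op_scaleC (- c) T = - op_scaleC c T" "op_scaleC c (- T) = - op_scaleC c T"
  using op_scaleC_scaleC[of "-1" c T] op_scaleC_scaleC[of c "-1" T]
  by (simp_all add: op_scaleC_minus_one)

lemma op_scaleC_cancel:
  assumes "op_scaleC c S = op_scaleC c T" "c \<noteq> 0"
  shows "S = T"
proof -
  have "op_scaleC (1 / c) (op_scaleC c R) = R" for R :: "'a op"
    using assms(2) by (intro blinfun_eqI) (simp add: scaleC_scaleC)
  then show ?thesis
    using assms(1) by metis
qed

lemma commutantI:
  "T \<in> bounded_ops \<Longrightarrow> (\<And>a. a \<in> A \<Longrightarrow> T o\<^sub>L a = a o\<^sub>L T) \<Longrightarrow> T \<in> commutant A"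
  by (simp add: commutant_def)

lemma commutantD:
  assumes "T \<in> commutant A"
  shows "T \<in> bounded_ops" "a \<in> A \<Longrightarrow> T o\<^sub>L a = a o\<^sub>L T"
  using assms by (auto simp: commutant_def)

lemma von_neumann_bounded: "von_neumann_algebra M \<Longrightarrow> x \<in> M \<Longrightarrow> x \<in> bounded_ops"
  by (auto simp: von_neumann_algebra_def)

lemma von_neumann_memI:
  assumes "von_neumann_algebra M" "T \<in> bounded_ops" "\<And>a. a \<in> commutant M \<Longrightarrow> T o\<^sub>L a = a o\<^sub>L T"
  shows "T \<in> M"
  using assms commutantI[of T "commutant M"] by (auto simp: von_neumann_algebra_def)

lemma von_neumann_commute:
  assumes "x \<in> M" "a \<in> commutant M"
  shows "x o\<^sub>L a = a o\<^sub>L x"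
  using commutantD(2)[OF assms(2,1)] by simp

lemma von_neumann_star_algebra:
  assumes M: "von_neumann_algebra M"
  shows "star_algebra M"
  unfolding star_algebra_def
proof (intro conjI ballI allI)
  note b = von_neumann_bounded[OF M]
  show "M \<subseteq> bounded_ops" and "\<And>x. x \<in> M \<Longrightarrow> op_adj x \<in> M"
    using M by (auto simp: von_neumann_algebra_def)
  show "id_blinfun \<in> M"
    by (rule von_neumann_memI[OF M]) (auto simp: op_compose_simps)
  fix x
  assume x: "x \<in> M"
  show "op_scaleC c x \<in> M" for c
    by (rule von_neumann_memI[OF M])
      (use x b von_neumann_commute[OF x] in \<open>auto simp: op_scaleC_compose dest: commutantD(1)\<close>)
  fix y
  assume y: "y \<in> M"
  show "x + y \<in> M"
    by (rule von_neumann_memI[OF M])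
      (use b x y in \<open>auto simp: op_compose_simps von_neumann_commute[OF x] von_neumann_commute[OF y]\<close>)
  show "x o\<^sub>L y \<in> M"
  proof (rule von_neumann_memI[OF M])
    show "x o\<^sub>L y o\<^sub>L a = a o\<^sub>L (x o\<^sub>L y)" if "a \<in> commutant M" for a
      by (simp add: op_compose_simps(9) von_neumann_commute[OF y that])
        (simp add: von_neumann_commute[OF x that] flip: op_compose_simps(9))
  qed (use x y b in auto)
qed

lemma closed_bounded_ops: "closed (bounded_ops :: ('h::chilbert_space) op set)"
proof -
  have "closed (\<Inter>c x. {T :: 'h op. T (c *\<^sub>C x) = c *\<^sub>C T x})"
    by (intro closed_INT ballI closed_Collect_eq continuous_intros
        bounded_linear.continuous_on[OF bounded_linear_scaleC])
  also have "(\<Inter>c x. {T :: 'h op. T (c *\<^sub>C x) = c *\<^sub>C T x}) = bounded_ops"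
    by (auto simp: bounded_ops_def)
  finally show ?thesis .
qed

text \<open>A von Neumann algebra is a commutant, and multiplication is norm-continuous. Closedness
  supplies the completeness for the fixed point arguments that produce inverses and square roots
  inside the algebra.\<close>

lemma closed_von_neumann:
  assumes M: "von_neumann_algebra M"
  shows "closed M"
proof -
  define R where "R = bounded_ops \<inter> (\<Inter>a\<in>commutant M. {T. T o\<^sub>L a = a o\<^sub>L T})"
  have "M = R"
    by (auto simp: R_def intro: von_neumann_bounded[OF M] von_neumann_memI[OF M] von_neumann_commute)
  moreover have "closed {T. T o\<^sub>L a = a o\<^sub>L T}" for a :: "'a op"
    by (rule closed_Collect_eq)
      (rule linear_continuous_on bounded_bilinear.bounded_linear_left[OF bounded_bilinear_blinfun_compose]
        bounded_bilinear.bounded_linear_right[OF bounded_bilinear_blinfun_compose])+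
  then have "closed R"
    unfolding R_def by (intro closed_Int closed_bounded_ops closed_INT ballI)
  ultimately show ?thesis
    by simp
qed

subsection \<open>Inverses, unitaries and square roots\<close>

lemma norm_blinfun_compose_le:
  "norm A \<le> a \<Longrightarrow> norm B \<le> b \<Longrightarrow> norm (A o\<^sub>L B) \<le> a * b"
  by (rule order_trans[OF norm_blinfun_compose mult_mono]) (auto intro: order_trans[OF norm_ge_zero])

text \<open>Right and left inverses are the fixed points of s \<mapsto> 1 + b s and t \<mapsto> 1 +
  t b, contractions of A with constant \<open>norm b\<close>; associativity identifies them.\<close>

lemma neumann_inverse:
  assumes A: "star_algebra A" "closed A" and b: "b \<in> A" "norm b < 1"
  obtains s where "s \<in> A" "s o\<^sub>L (id_blinfun - b) = id_blinfun" "(id_blinfun - b) o\<^sub>L s = id_blinfun"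
proof -
  note id = star_algebra_id[OF A(1)]
  have ex: "\<exists>s\<in>A. f s = s"
    if "\<And>s. s \<in> A \<Longrightarrow> f s \<in> A" "\<And>s t. norm (f s - f t) \<le> norm b * norm (s - t)" for f
    using Banach_fix[of A "norm b" f] that b A id by (auto simp: complete_eq_closed dist_norm)
  have "\<exists>s\<in>A. id_blinfun + (b o\<^sub>L s) = s"
  proof (rule ex)
    show "norm (id_blinfun + (b o\<^sub>L s) - (id_blinfun + (b o\<^sub>L t))) \<le> norm b * norm (s - t)" for s t
      using norm_blinfun_compose[of b "s - t"] by (simp add: op_compose_simps)
  qed (simp add: b id star_algebra_add[OF A(1)] star_algebra_compose[OF A(1)])
  then obtain s where s: "s \<in> A" "id_blinfun + (b o\<^sub>L s) = s"
    by blast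
  have "\<exists>s\<in>A. id_blinfun + (s o\<^sub>L b) = s"
  proof (rule ex)
    show "norm (id_blinfun + (s o\<^sub>L b) - (id_blinfun + (t o\<^sub>L b))) \<le> norm b * norm (s - t)" for s t
      using norm_blinfun_compose[of "s - t" b] by (simp add: op_compose_simps mult.commute)
  qed (simp add: b id star_algebra_add[OF A(1)] star_algebra_compose[OF A(1)])
  then obtain t where t: "t \<in> A" "id_blinfun + (t o\<^sub>L b) = t"
    by blast
  have right: "(id_blinfun - b) o\<^sub>L s = id_blinfun"
    using s by (simp add: op_compose_simps diff_eq_eq)
  have left: "t o\<^sub>L (id_blinfun - b) = id_blinfun"
    using t by (simp add: op_compose_simps diff_eq_eq)
  have "t = s"
    by (metis left right op_compose_simps(9,10,11))
  then show ?thesis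
    using that left right s by blast
qed

text \<open>The isometries of the proof are Cayley transforms of small self-adjoint elements.\<close>

lemma commute_all_isometries:
  assumes N: "star_algebra N" "closed N" and z: "z \<in> bounded_ops"
    and u: "\<And>u. u \<in> N \<Longrightarrow> op_adj u o\<^sub>L u = id_blinfun \<Longrightarrow> z o\<^sub>L u = u o\<^sub>L z"
  shows "z \<in> commutant N"
proof -
  note bd = star_algebra_bounded[OF N(1)]
  have small: "z o\<^sub>L b = b o\<^sub>L z" if b: "b \<in> N" "op_adj b = b" "norm b < 1" for b
  proof -
    define c where "c = op_scaleC \<i> b"
    define T where "T = id_blinfun - c"
    have c: "c \<in> N"
      using b star_algebra_scaleC[OF N(1)] by (simp add: c_def)
    have "norm c \<le> norm b"
      by (rule norm_blinfun_bound) (auto simp: c_def norm_scaleC norm_blinfun)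
    then obtain s where s: "s \<in> N" "s o\<^sub>L T = id_blinfun" "T o\<^sub>L s = id_blinfun"
      using neumann_inverse[OF N c] b(3) by (auto simp: T_def)
    \<comment> \<open>Since s inverts 1 - c, this is the Cayley transform (1 + c) s of the
      skew-adjoint c = \<i>b. Commuting with w amounts to commuting with s.\<close>
    define w where "w = s + s - id_blinfun"
    have w: "w \<in> N"
      unfolding w_def using s star_algebra_add[OF N(1)] star_algebra_diff[OF N(1)]
        star_algebra_id[OF N(1)] by blast
    have "op_adj c = - c"
      using b bd[OF b(1)] by (simp add: c_def op_adj_simps op_scaleC_scaleC flip: op_scaleC_minus_one)
    then have adjT: "op_adj T = id_blinfun + c"
      using bd[OF c] by (simp add: T_def op_adj_simps)
    have w_eq: "w = op_adj T o\<^sub>L s"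
    proof -
      have "op_adj T o\<^sub>L s = (id_blinfun + id_blinfun - T) o\<^sub>L s"
        unfolding adjT by (simp add: T_def)
      also have "\<dots> = w"
        by (simp only: op_compose_simps s w_def)
      finally show ?thesis ..
    qed
    have TT: "T o\<^sub>L op_adj T = op_adj T o\<^sub>L T"
      unfolding adjT by (simp add: T_def op_compose_simps)
    have T: "T \<in> bounded_ops"
      using c bd by (auto simp: T_def)
    have "op_adj w o\<^sub>L w = op_adj s o\<^sub>L (T o\<^sub>L op_adj T) o\<^sub>L s"
      using bd[OF s(1)] op_adj_works(2)[OF T] T
      by (simp add: w_eq op_adj_simps op_compose_simps(9))
    also have "\<dots> = op_adj (T o\<^sub>L s) o\<^sub>L (T o\<^sub>L s)"
      unfolding TT using T bd[OF s(1)] by (simp add: op_adj_simps op_compose_simps(9))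
    finally have "op_adj w o\<^sub>L w = id_blinfun"
      by (simp add: s op_compose_simps)
    then have "z o\<^sub>L w = w o\<^sub>L z"
      using u w by blast
    then have "2 *\<^sub>R (z o\<^sub>L s) = 2 *\<^sub>R (s o\<^sub>L z)"
      by (simp add: w_def op_compose_simps scaleR_2)
    then have zs: "z o\<^sub>L s = s o\<^sub>L z"
      by simp
    \<comment> \<open>Commutation passes from s to its inverse T by multiplying with T on both
      sides.\<close>
    have "T o\<^sub>L z = T o\<^sub>L (z o\<^sub>L s) o\<^sub>L T"
      by (simp add: op_compose_simps s)
    also have "\<dots> = z o\<^sub>L T"
      by (simp add: zs s flip: op_compose_simps(9)) (simp add: op_compose_simps)
    finally have "op_scaleC \<i> (z o\<^sub>L b) = op_scaleC \<i> (b o\<^sub>L z)"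
      using z by (simp add: T_def c_def op_compose_simps op_scaleC_compose)
    then show ?thesis
      by (rule op_scaleC_cancel) simp
  qed
  have sa: "z o\<^sub>L b = b o\<^sub>L z" if b: "b \<in> N" "op_adj b = b" for b
  proof -
    \<comment> \<open>Scaling brings b into the open unit ball; the added 1 covers b = 0.\<close>
    define r where "r = 1 / (norm b + 1)"
    have r: "0 < r" "norm (r *\<^sub>R b) < 1"
      by (auto simp: r_def add_nonneg_pos)
    have "z o\<^sub>L (r *\<^sub>R b) = (r *\<^sub>R b) o\<^sub>L z"
      using b bd[OF b(1)] r star_algebra_scaleR[OF N(1)] by (intro small) (auto simp: op_adj_simps)
    then show ?thesis
      using r by (simp add: op_compose_simps)
  qed
  have "z o\<^sub>L a = a o\<^sub>L z" if a: "a \<in> N" for a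
  proof -
    note a' = star_algebra_adj[OF N(1) a]
    note ab = bd[OF a] bd[OF a']
    \<comment> \<open>The self-adjoint elements a + \<open>op_adj a\<close> and \<i>(a -
      \<open>op_adj a\<close>) together determine a.\<close>
    have 1: "z o\<^sub>L (a + op_adj a) = (a + op_adj a) o\<^sub>L z"
      using a a' ab by (intro sa) (auto simp: op_adj_simps add.commute star_algebra_add[OF N(1)])
    have 2: "z o\<^sub>L op_scaleC \<i> (a - op_adj a) = op_scaleC \<i> (a - op_adj a) o\<^sub>L z"
    proof (rule sa)
      have "op_adj (op_scaleC \<i> (a - op_adj a)) = op_scaleC (- \<i>) (- (a - op_adj a))"
        using ab by (simp add: op_adj_simps)
      then show "op_adj (op_scaleC \<i> (a - op_adj a)) = op_scaleC \<i> (a - op_adj a)"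
        by (simp only: op_scaleC_minus minus_minus)
    qed (simp add: a a' star_algebra_scaleC[OF N(1)] star_algebra_diff[OF N(1)])
    then have "op_scaleC \<i> (z o\<^sub>L (a - op_adj a)) = op_scaleC \<i> ((a - op_adj a) o\<^sub>L z)"
      using z by (simp add: op_scaleC_compose)
    then have "z o\<^sub>L (a - op_adj a) = (a - op_adj a) o\<^sub>L z"
      by (rule op_scaleC_cancel) simp
    with 1 have "(z o\<^sub>L (a + op_adj a)) + (z o\<^sub>L (a - op_adj a))
        = ((a + op_adj a) o\<^sub>L z) + ((a - op_adj a) o\<^sub>L z)"
      by simp
    then have "2 *\<^sub>R (z o\<^sub>L a) = 2 *\<^sub>R (a o\<^sub>L z)"
      by (simp add: op_compose_simps scaleR_2)
    then show ?thesis
      by simp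
  qed
  then show ?thesis
    using z by (intro commutantI)
qed

text \<open>Self-adjointness is rewritten as a family of identities between inner products, each of
  which is closed in x.\<close>

lemma closed_self_adjoint:
  assumes "closed A" "A \<subseteq> bounded_ops"
  shows "closed {x \<in> A. op_adj x = x}"
proof -
  have "op_adj x = x \<longleftrightarrow> (\<forall>v w. cinner (x v) w = cinner v (x w))" if "x \<in> A" for x
    using assms(2) that by (metis op_adj_works(1) op_adj_eqI subsetD)
  then have "{x \<in> A. op_adj x = x} = A \<inter> (\<Inter>v w. {x. cinner (blinfun_apply x v) w = cinner v (x w)})"
    by auto
  then show ?thesis
    by (auto intro!: closed_Int closed_INT closed_Collect_eq assms continuous_intros
        bounded_bilinear.continuous_on[OF bounded_bilinear_cinner])
qed

text \<open>
  With \<open>y\<close> the fixed point of $y \mapsto (s + y^2) / 2$, the square root of $1 - s$ is $1 - y$.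
\<close>

lemma sqrt_one_minus:
  assumes A: "star_algebra A" "closed A" and s: "s \<in> A" "op_adj s = s" "norm s < 1"
  obtains y where "y \<in> A" "op_adj y = y" "(id_blinfun - y) o\<^sub>L (id_blinfun - y) = id_blinfun - s"
proof -
  \<comment> \<open>The smaller root of r = (\<open>norm s\<close> + r r) / 2. With this radius f
    maps the ball into itself, and r < 1 is also its contraction constant.\<close>
  define r where "r = 1 - sqrt (1 - norm s)"
  have r: "0 \<le> r" "r < 1"
    using s by (auto simp: r_def)
  have "(1 - r)\<^sup>2 = 1 - norm s"
    using s by (simp add: r_def)
  then have r2: "(norm s + r * r) / 2 = r"
    by (simp add: power2_eq_square algebra_simps)
  define K where "K = {y \<in> A. op_adj y = y} \<inter> cball 0 r"
  define f where "f y = (1/2) *\<^sub>R (s + (y o\<^sub>L y))" for y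
  have "complete K"
    unfolding K_def complete_eq_closed using A
    by (intro closed_Int closed_self_adjoint) (auto simp: star_algebra_def)
  moreover have "0 \<in> K"
    using star_algebra_scaleR[OF A(1) star_algebra_id[OF A(1)], of 0] r
    by (auto simp: K_def intro!: op_adj_eqI) (simp add: bounded_ops_def)
  moreover have "f ` K \<subseteq> K"
  proof
    fix x
    assume "x \<in> f ` K"
    then obtain y where y: "y \<in> A" "op_adj y = y" "norm y \<le> r" "x = f y"
      by (auto simp: K_def)
    have "norm (s + (y o\<^sub>L y)) \<le> norm s + r * r"
      using y norm_blinfun_compose_le norm_triangle_mono by blast
    then have "norm x \<le> r"
      using y r2 by (simp add: f_def)
    then show "x \<in> K"
      using y s star_algebra_bounded[OF A(1)]
      by (auto simp: K_def f_def op_adj_simps star_algebra_scaleR[OF A(1)] star_algebra_add[OF A(1)]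
          star_algebra_compose[OF A(1)])
  qed
  moreover have "dist (f x) (f y) \<le> r * dist x y" if "x \<in> K" "y \<in> K" for x y
  proof -
    have "f x - f y = (1/2) *\<^sub>R (((x - y) o\<^sub>L x) + (y o\<^sub>L (x - y)))"
      by (simp add: f_def op_compose_simps algebra_simps)
    moreover have "norm (((x - y) o\<^sub>L x) + (y o\<^sub>L (x - y))) \<le> norm (x - y) * r + r * norm (x - y)"
      using that by (intro norm_triangle_mono norm_blinfun_compose_le) (auto simp: K_def)
    ultimately show ?thesis
      by (simp add: dist_norm)
  qed
  ultimately obtain y where "y \<in> K" "f y = y"
    using Banach_fix[of K r f] r by blast
  moreover from this have "s = 2 *\<^sub>R y - (y o\<^sub>L y)"
    by (simp add: f_def) (metis add_diff_cancel_right' scaleR_half_double scaleR_2 scaleR_add_right)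
  then have "(id_blinfun - y) o\<^sub>L (id_blinfun - y) = id_blinfun - s"
    by (simp add: op_compose_simps scaleR_2)
  ultimately show ?thesis
    using that by (auto simp: K_def)
qed

subsection \<open>Positive operators\<close>

lemma nonneg_quadratic_discriminant:
  fixes a b c :: real
  assumes "\<And>t. 0 \<le> a + 2 * t * b + t\<^sup>2 * c" "0 \<le> c"
  shows "b\<^sup>2 \<le> a * c"
proof (cases "c = 0")
  case True
  have "b = 0"
  proof (rule ccontr)
    assume "b \<noteq> 0"
    then show False
      \<comment> \<open>At this t the polynomial, linear because c = 0, takes the value -1.\<close>
      using assms(1)[of "- (a + 1) / (2 * b)"] True by (simp add: field_simps)
  qed
  then show ?thesis
    by (simp add: True)
next
  case False
  \<comment> \<open>Evaluation at the minimising point t = -b / c.\<close>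
  then have "0 \<le> (a + 2 * (- b / c) * b + (- b / c)\<^sup>2 * c) * c"
    using assms by (intro mult_nonneg_nonneg)
  also have "\<dots> = a * c - b\<^sup>2"
    using False by (simp add: field_simps power2_eq_square)
  finally show ?thesis
    by simp
qed

lemma op_pos_inner: "op_pos T \<Longrightarrow> 0 \<le> inner (blinfun_apply T x) x"
  by (simp add: op_pos_def nonneg_Reals_iff inner_eq_Re_cinner)

lemma op_posI:
  assumes "op_adj T = T" "T \<in> bounded_ops" "\<And>x. 0 \<le> inner (blinfun_apply T x) x"
  shows "op_pos T"
proof -
  have "cinner (T x) x \<in> \<real>" for x
    using op_adj_works(1)[OF assms(2), of x x] assms(1) cinner_commute[of "T x" x]
    by (simp add: Reals_cnj_iff)
  then show ?thesis
    using assms(3) by (auto simp: op_pos_def nonneg_Reals_iff inner_eq_Re_cinner complex_is_Real_iff)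
qed

lemma op_adj_inner:
  "T \<in> bounded_ops \<Longrightarrow> inner (blinfun_apply (op_adj T) x) y = inner x (blinfun_apply T y)"
  by (simp add: inner_eq_Re_cinner op_adj_works)

lemma op_pos_Cauchy_Schwarz:
  assumes T: "T \<in> bounded_ops" "op_pos T"
  shows "(inner (blinfun_apply T x) y)\<^sup>2 \<le> inner (T x) x * inner (T y) y"
proof (rule nonneg_quadratic_discriminant)
  fix t
  have "inner (T y) x = inner (T x) y"
    using op_adj_inner[OF T(1), of y x] op_pos_adj[OF T] by (simp add: inner_commute)
  then show "0 \<le> inner (T x) x + 2 * t * inner (T x) y + t\<^sup>2 * inner (T y) y"
    using op_pos_inner[OF T(2), of "x + t *\<^sub>R y"]
    by (simp add: blinfun.bilinear_simps inner_add_left inner_add_right power2_eq_square algebra_simps)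
qed (rule op_pos_inner[OF T(2)])

text \<open>In operator terms, T T \<le> q T whenever 0 \<le> T \<le> q: Cauchy--Schwarz for the
  form of T at the vectors x and T x, with one factor of the squared norm of T x cancelled.\<close>

lemma op_pos_norm_power2_le:
  assumes T: "T \<in> bounded_ops" "op_pos T" and q: "\<And>x. inner (blinfun_apply T x) x \<le> q * (norm x)\<^sup>2"
  shows "(norm (T x))\<^sup>2 \<le> q * inner (T x) x"
proof (cases "T x = 0")
  case False
  have "((norm (T x))\<^sup>2)\<^sup>2 \<le> inner (T x) x * inner (T (T x)) (T x)"
    using op_pos_Cauchy_Schwarz[OF T, of x "T x"] by (simp add: power2_norm_eq_inner)
  also have "\<dots> \<le> inner (T x) x * (q * (norm (T x))\<^sup>2)"
    by (intro mult_left_mono q op_pos_inner T)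
  finally show ?thesis
    using False by (simp add: power2_eq_square mult_ac)
qed simp

lemma op_pos_norm_le:
  assumes T: "T \<in> bounded_ops" "op_pos T" and q: "\<And>x. inner (blinfun_apply T x) x \<le> q * (norm x)\<^sup>2"
    and "0 \<le> q"
  shows "norm T \<le> q"
proof (rule norm_blinfun_bound)
  fix x
  have "(norm (T x))\<^sup>2 \<le> q * (q * (norm x)\<^sup>2)"
    using op_pos_norm_power2_le[OF T q, of x] q[of x] assms(4) by (meson mult_left_mono order_trans)
  then have "(norm (T x))\<^sup>2 \<le> (q * norm x)\<^sup>2"
    by (simp add: power2_eq_square mult_ac)
  then show "norm (T x) \<le> q * norm x"
    by (rule power2_le_imp_le) (simp add: assms(4))
qed fact

lemma inner_blinfun_le: "inner (blinfun_apply T x) x \<le> norm T * (norm x)\<^sup>2"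
proof -
  have "inner (T x) x \<le> norm (T x) * norm x"
    by (rule norm_cauchy_schwarz)
  also have "\<dots> \<le> norm T * norm x * norm x"
    by (intro mult_right_mono norm_blinfun) auto
  finally show ?thesis
    by (simp add: power2_eq_square mult.assoc)
qed

section \<open>Von Neumann algebras with a faithful normal trace\<close>

locale tracial_algebra =
  fixes M :: "('h::chilbert_space) op set" and \<tau> :: "'h op \<Rightarrow> complex"
  assumes M: "von_neumann_algebra M" and \<tau>: "tracial_state M id_blinfun \<tau>"
begin

lemmas star = von_neumann_star_algebra[OF M]
lemmas bounded [simp] = star_algebra_bounded[OF star]
lemmas mem [simp] = star_algebra_id[OF star] star_algebra_adj[OF star] star_algebra_add[OF star]
  star_algebra_diff[OF star] star_algebra_compose[OF star] star_algebra_scaleC[OF star]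
  star_algebra_scaleR[OF star]

lemma
  shows trace_add: "x \<in> M \<Longrightarrow> y \<in> M \<Longrightarrow> \<tau> (x + y) = \<tau> x + \<tau> y"
    and trace_scaleC: "x \<in> M \<Longrightarrow> \<tau> (op_scaleC c x) = c * \<tau> x"
    and trace_id: "\<tau> id_blinfun = 1"
    and trace_adj_self: "x \<in> M \<Longrightarrow> \<tau> (op_adj x o\<^sub>L x) \<in> \<real>\<^sub>\<ge>\<^sub>0"
    and trace_adj_self_eq_0: "x \<in> M \<Longrightarrow> \<tau> (op_adj x o\<^sub>L x) = 0 \<Longrightarrow> x = 0"
    and trace_continuous: "continuous_map (subtopology ultraweak_topology M) euclidean \<tau>"
    and trace_commute: "x \<in> M \<Longrightarrow> y \<in> M \<Longrightarrow> \<tau> (x o\<^sub>L y) = \<tau> (y o\<^sub>L x)"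
proof -
  note * = \<tau>[unfolded tracial_state_def]
  show "x \<in> M \<Longrightarrow> y \<in> M \<Longrightarrow> \<tau> (x + y) = \<tau> x + \<tau> y"
    using * by (elim conjE) simp
  show "x \<in> M \<Longrightarrow> \<tau> (op_scaleC c x) = c * \<tau> x"
    using * by (elim conjE) simp
  show "\<tau> id_blinfun = 1"
    using * by (elim conjE)
  show "x \<in> M \<Longrightarrow> \<tau> (op_adj x o\<^sub>L x) \<in> \<real>\<^sub>\<ge>\<^sub>0"
    using * by (elim conjE) (erule bspec)
  show "x \<in> M \<Longrightarrow> \<tau> (op_adj x o\<^sub>L x) = 0 \<Longrightarrow> x = 0"
    using * by (elim conjE) simp
  show "continuous_map (subtopology ultraweak_topology M) euclidean \<tau>"
    using * by (elim conjE)
  show "x \<in> M \<Longrightarrow> y \<in> M \<Longrightarrow> \<tau> (x o\<^sub>L y) = \<tau> (y o\<^sub>L x)"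
    using * by (elim conjE) (drule (1) bspec)+
qed

lemma trace_scaleR: "x \<in> M \<Longrightarrow> \<tau> (r *\<^sub>R x) = of_real r * \<tau> x"
  using trace_scaleC[of x "of_real r"] by (simp add: op_scaleC_of_real)

lemma trace_diff: "x \<in> M \<Longrightarrow> y \<in> M \<Longrightarrow> \<tau> (x - y) = \<tau> x - \<tau> y"
  using trace_add[of "x - y" y] by simp

text \<open>To write d as a product covered by \<open>tracial_state\<close> a square root is needed.
  The square root construction requires distance less than 1 from the identity, so it is applied to
  a multiple of d + e for e > 0, and e then tends to 0.\<close>

lemma trace_pos:
  assumes d: "d \<in> M" "op_pos d"
  shows "\<tau> d \<in> \<real>\<^sub>\<ge>\<^sub>0"
proof -
  have sa: "op_adj d = d"
    using d by (simp add: op_pos_adj)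
  have shift: "\<tau> d + of_real e \<in> \<real>\<^sub>\<ge>\<^sub>0" if e: "0 < e" for e :: real
  proof -
    \<comment> \<open>With this C, 0 \<le> d \<le> \<open>norm d\<close> gives e / C \<le> (d + e) /
      C \<le> 1, so s lies between 0 and 1 - e / C.\<close>
    define C where "C = norm d + e"
    have C: "0 < C"
      using e by (simp add: C_def add_nonneg_pos)
    define s where "s = id_blinfun - (1 / C) *\<^sub>R (d + e *\<^sub>R id_blinfun)"
    have s: "s \<in> M" "op_adj s = s"
      using d sa by (simp_all add: s_def op_adj_simps)
    have inner_s: "inner (s x) x = (norm x)\<^sup>2 - (inner (d x) x + e * (norm x)\<^sup>2) / C" for x
      by (simp add: s_def inner_diff_left inner_add_left power2_norm_eq_inner)
    have "op_pos s"
    proof (rule op_posI)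
      show "0 \<le> inner (s x) x" for x
        using inner_blinfun_le[of d x] C by (simp add: inner_s C_def field_simps)
    qed (use s in auto)
    moreover have "inner (s x) x \<le> (1 - e / C) * (norm x)\<^sup>2" for x
      using op_pos_inner[OF d(2), of x] C by (simp add: inner_s field_simps)
    moreover have "0 \<le> 1 - e / C"
      using C by (simp add: C_def field_simps)
    ultimately have "norm s \<le> 1 - e / C"
      using op_pos_norm_le[of s "1 - e / C"] s by simp
    moreover have "0 < e / C"
      using e C by simp
    ultimately have "norm s < 1"
      by linarith
    then obtain y where y: "y \<in> M" "op_adj y = y"
      "(id_blinfun - y) o\<^sub>L (id_blinfun - y) = id_blinfun - s"
      using sqrt_one_minus[OF star closed_von_neumann[OF M] s] by blast
    have "op_adj (id_blinfun - y) o\<^sub>L (id_blinfun - y) = (1 / C) *\<^sub>R (d + e *\<^sub>R id_blinfun)"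
      using y by (simp add: op_adj_simps s_def)
    then have "of_real (1 / C) * (\<tau> d + of_real e) \<in> \<real>\<^sub>\<ge>\<^sub>0"
      using trace_adj_self[of "id_blinfun - y"] y d
      by (simp add: trace_scaleR trace_add trace_id)
    then show ?thesis
      using C by (simp add: nonneg_Reals_iff zero_le_divide_iff)
  qed
  have "0 \<le> Re (\<tau> d)"
  proof (rule field_le_epsilon)
    show "0 \<le> Re (\<tau> d) + e" if "0 < e" for e
      using shift[OF that] by (simp add: nonneg_Reals_iff)
  qed
  then show ?thesis
    using shift[of 1] by (simp add: nonneg_Reals_iff)
qed

text \<open>From d d \<le> \<open>norm d\<close> d the trace of d d is at most 0, and faithfulness
  on squares applies.\<close>

lemma trace_pos_eq_0:
  assumes d: "d \<in> M" "op_pos d" "\<tau> d = 0"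
  shows "d = 0"
proof -
  have sa: "op_adj d = d"
    using d by (simp add: op_pos_adj)
  have "op_pos (norm d *\<^sub>R d - (d o\<^sub>L d))"
  proof (rule op_posI)
    show "0 \<le> inner ((norm d *\<^sub>R d - (d o\<^sub>L d)) x) x" for x
      using op_pos_norm_power2_le[of d "norm d" x] d inner_blinfun_le[of d]
        op_adj_inner[of d "d x" x] sa
      by (simp add: inner_diff_left power2_norm_eq_inner)
  qed (use d sa in \<open>simp_all add: op_adj_simps\<close>)
  then have "\<tau> (norm d *\<^sub>R d - (d o\<^sub>L d)) \<in> \<real>\<^sub>\<ge>\<^sub>0"
    using d by (intro trace_pos) auto
  then have "- \<tau> (op_adj d o\<^sub>L d) \<in> \<real>\<^sub>\<ge>\<^sub>0"
    using d sa by (simp add: trace_diff trace_scaleR)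
  then have "\<tau> (op_adj d o\<^sub>L d) = 0"
    using trace_adj_self[OF d(1)] by (auto simp: nonneg_Reals_iff complex_eq_iff)
  then show ?thesis
    using trace_adj_self_eq_0 d by blast
qed

end

section \<open>The ultraweak topology\<close>

lemma openin_ultraweak_basic:
  "square_summable \<xi> \<Longrightarrow> square_summable \<eta> \<Longrightarrow> open U \<Longrightarrow>
    openin ultraweak_topology {T. (\<Sum>n. cinner (blinfun_apply T (\<xi> n)) (\<eta> n)) \<in> U}"
  unfolding ultraweak_topology_def by (rule topology_generated_by_Basis) blast

lemma topspace_ultraweak [simp]: "topspace (ultraweak_topology :: ('h::chilbert_space) op topology) = UNIV"
proof -
  have "openin ultraweak_topology (UNIV :: 'h op set)"
    using openin_ultraweak_basic[of "\<lambda>_. 0" "\<lambda>_. 0" UNIV] by (simp add: square_summable_def)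
  then show ?thesis
    using openin_subset by blast
qed

lemma continuous_map_into_ultraweak:
  fixes f :: "'a \<Rightarrow> ('h::chilbert_space) op"
  assumes "\<And>\<xi> \<eta>. square_summable \<xi> \<Longrightarrow> square_summable \<eta> \<Longrightarrow>
    continuous_map X euclidean (\<lambda>x. \<Sum>n. cinner (blinfun_apply (f x) (\<xi> n)) (\<eta> n))"
  shows "continuous_map X ultraweak_topology f"
proof -
  let ?\<S> = "{{T :: 'h op. (\<Sum>n. cinner (blinfun_apply T (\<xi> n)) (\<eta> n)) \<in> U} | \<xi> \<eta> U.
       square_summable \<xi> \<and> square_summable \<eta> \<and> open U}"
  have "continuous_map X (topology_generated_by ?\<S>) f"
  proof (rule continuous_on_generated_topo)
    fix V
    assume "V \<in> ?\<S>"
    then obtain \<xi> \<eta> U where V: "V = {T. (\<Sum>n. cinner (blinfun_apply T (\<xi> n)) (\<eta> n)) \<in> U}"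
      "square_summable \<xi>" "square_summable \<eta>" "open U"
      by blast
    have "f -` V \<inter> topspace X
        = {x \<in> topspace X. (\<Sum>n. cinner (blinfun_apply (f x) (\<xi> n)) (\<eta> n)) \<in> U}"
      by (auto simp: V(1))
    moreover have "openin X \<dots>"
      by (rule openin_continuous_map_preimage[OF assms[OF V(2,3)]]) (use V in auto)
    ultimately show "openin X (f -` V \<inter> topspace X)"
      by simp
  next
    show "f ` topspace X \<subseteq> \<Union>?\<S>"
      using topspace_ultraweak[where 'h = 'h, unfolded ultraweak_topology_def topology_generated_by_topspace]
      by simp
  qed
  then show ?thesis
    by (simp add: ultraweak_topology_def)
qed

lemma continuous_map_ultraweak_functional:
  assumes "square_summable \<xi>" "square_summable \<eta>"
  shows "continuous_map ultraweak_topology euclidean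
    (\<lambda>T. \<Sum>n. cinner (blinfun_apply T (\<xi> n)) (\<eta> n))"
  using openin_ultraweak_basic[OF assms] by (simp add: continuous_map_def)

text \<open>In each defining functional the factor a moves to the second sequence as its adjoint,
  which keeps that sequence square-summable.\<close>

lemma continuous_map_compose_left:
  assumes a: "a \<in> bounded_ops"
  shows "continuous_map ultraweak_topology ultraweak_topology (\<lambda>x. a o\<^sub>L x)"
proof (rule continuous_map_into_ultraweak)
  fix \<xi> \<eta> :: "nat \<Rightarrow> 'a"
  assume "square_summable \<xi>" "square_summable \<eta>"
  then show "continuous_map ultraweak_topology euclidean
      (\<lambda>x. \<Sum>n. cinner (blinfun_apply (a o\<^sub>L x) (\<xi> n)) (\<eta> n))"
    using continuous_map_ultraweak_functional[OF _ square_summable_blinfun[of \<eta> "op_adj a"], of \<xi>]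
    by (simp add: op_adj_right[OF a])
qed

subsection \<open>Compactness of balls\<close>

text \<open>
  Operators are identified with their sesquilinear forms, which form a closed subset of a
  product of discs.
\<close>

lemma continuous_on_ultraweak_functional_forms:
  fixes S :: "('h::chilbert_space \<times> 'h \<Rightarrow> complex) set"
  assumes bound: "\<And>f x y. f \<in> S \<Longrightarrow> cmod (f (x, y)) \<le> R * norm x * norm y"
    and sq: "square_summable \<xi>" "square_summable \<eta>"
  shows "continuous_on S (\<lambda>f. \<Sum>n. f (\<xi> n, \<eta> n))"
proof (rule uniform_limit_theorem)
  have "summable (\<lambda>n. norm (\<xi> n) * norm (\<eta> n))"
    using summable_inner(1) sq by (auto simp: square_summable_def)
  then have "summable (\<lambda>n. R * norm (\<xi> n) * norm (\<eta> n))"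
    by (simp add: mult.assoc summable_mult)
  \<comment> \<open>Weierstrass M-test: on S the series converges uniformly, and each partial sum
    depends on finitely many coordinates only.\<close>
  then show "uniform_limit S (\<lambda>N f. \<Sum>n<N. f (\<xi> n, \<eta> n)) (\<lambda>f. \<Sum>n. f (\<xi> n, \<eta> n)) sequentially"
    using bound by (intro Weierstrass_m_test[where M = "\<lambda>n. R * norm (\<xi> n) * norm (\<eta> n)"]) auto
  show "\<forall>\<^sub>F N in sequentially. continuous_on S (\<lambda>f. \<Sum>n<N. f (\<xi> n, \<eta> n))"
    by (intro always_eventually allI continuous_on_sum)
      (rule continuous_on_subset[OF continuous_on_product_coordinates], simp)
qed simp

lemma compactin_ultraweak_ball:
  assumes M: "von_neumann_algebra M"
  shows "compactin ultraweak_topology {z \<in> M. norm z \<le> R}"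
proof (cases "0 \<le> R")
  case False
  then have "{z \<in> M. norm z \<le> R} = {}"
    by (auto dest: order_trans[OF norm_ge_zero])
  then show ?thesis
    by (simp only: compactin_empty)
next
  case R: True
  \<comment> \<open>A product of closed discs, compact by Tychonoff's theorem.\<close>
  define D where "D = (PiE UNIV (\<lambda>(x::'a, y::'a). cball 0 (R * norm x * norm y)) :: ('a \<times> 'a \<Rightarrow> complex) set)"
  \<comment> \<open>The last clause expresses that the operator of the form commutes with the
    commutant of M, so that it lies in M by the bicommutant property; all clauses are closed
    conditions.\<close>
  define L where "L = {f :: 'a \<times> 'a \<Rightarrow> complex.
      (\<forall>x y z. f (x + y, z) = f (x, z) + f (y, z)) \<and> (\<forall>x y z. f (x, y + z) = f (x, y) + f (x, z)) \<and>
      (\<forall>c x y. f (c *\<^sub>C x, y) = c * f (x, y)) \<and> (\<forall>c x y. f (x, c *\<^sub>C y) = cnj c * f (x, y)) \<and>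
      (\<forall>a\<in>commutant M. \<forall>x y. f (blinfun_apply a x, y) = f (x, blinfun_apply (op_adj a) y))}"
  define S where "S = D \<inter> L"
  have "compactin euclidean D"
    unfolding D_def euclidean_product_topology[symmetric] compactin_PiE by (auto simp: compactin_euclidean_iff)
  moreover have "closed L"
    unfolding L_def Ball_def
    by (intro closed_Collect_conj closed_Collect_all closed_Collect_imp closed_Collect_eq
        open_Collect_const continuous_intros continuous_on_product_coordinates)
  ultimately have "compact S"
    unfolding S_def by (simp add: compactin_euclidean_iff compact_Int_closed)
  have bound: "cmod (f (x, y)) \<le> R * norm x * norm y" if "f \<in> S" for f x y
    using that by (auto simp: S_def D_def PiE_iff)
  have "\<exists>T. T \<in> bounded_ops \<and> norm T \<le> R \<and> (\<forall>x y. cinner (blinfun_apply T x) y = f (x, y))"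
    if f: "f \<in> S" for f
  proof -
    obtain T where "T \<in> bounded_ops" "\<And>x y. cinner (blinfun_apply T x) y = f (x, y)"
      "\<And>x. norm (blinfun_apply T x) \<le> R * norm x"
      by (rule sesquilinear_representation[of "\<lambda>x y. f (x, y)" R])
        (use f bound[OF f] in \<open>auto simp: S_def L_def\<close>)
    moreover from this have "norm T \<le> R"
      using R by (intro norm_blinfun_bound)
    ultimately show ?thesis
      by blast
  qed
  then have "\<exists>j. \<forall>f\<in>S. j f \<in> bounded_ops \<and> norm (j f) \<le> R \<and>
      (\<forall>x y. cinner (blinfun_apply (j f) x) y = f (x, y))"
    by (intro bchoice) blast
  then obtain j where j: "\<And>f. f \<in> S \<Longrightarrow> j f \<in> bounded_ops" "\<And>f. f \<in> S \<Longrightarrow> norm (j f) \<le> R"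
    "\<And>f x y. f \<in> S \<Longrightarrow> cinner (blinfun_apply (j f) x) y = f (x, y)"
    by blast
  \<comment> \<open>The map from forms back to operators is the one that has to be continuous, since
    compactness is carried from S to the ball.\<close>
  have "continuous_map (top_of_set S) ultraweak_topology j"
  proof (rule continuous_map_into_ultraweak)
    fix \<xi> \<eta> :: "nat \<Rightarrow> 'a"
    assume sq: "square_summable \<xi>" "square_summable \<eta>"
    have "continuous_on S (\<lambda>f. \<Sum>n. f (\<xi> n, \<eta> n))"
      by (rule continuous_on_ultraweak_functional_forms[where R = R]) (use bound sq in auto)
    then have "continuous_on S (\<lambda>f. \<Sum>n. cinner (blinfun_apply (j f) (\<xi> n)) (\<eta> n))"
      by (rule continuous_on_eq) (simp add: j)
    then show "continuous_map (top_of_set S) euclidean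
        (\<lambda>f. \<Sum>n. cinner (blinfun_apply (j f) (\<xi> n)) (\<eta> n))"
      by simp
  qed
  then have "compactin ultraweak_topology (j ` S)"
    using \<open>compact S\<close> by (intro image_compactin) (auto simp: compactin_subtopology compactin_euclidean_iff)
  moreover have "j ` S = {z \<in> M. norm z \<le> R}"
  proof
    show "j ` S \<subseteq> {z \<in> M. norm z \<le> R}"
    proof clarify
      fix f
      assume f: "f \<in> S"
      have "j f \<in> M"
      proof (rule von_neumann_memI[OF M j(1)[OF f]])
        fix a
        assume a: "a \<in> commutant M"
        show "j f o\<^sub>L a = a o\<^sub>L j f"
        proof (rule blinfun_eqI, rule cinner_eqI)
          fix x y
          have "f (a x, y) = f (x, op_adj a y)"
            using f a by (simp add: S_def L_def)
          then show "cinner ((j f o\<^sub>L a) x) y = cinner ((a o\<^sub>L j f) x) y"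
            using commutantD(1)[OF a] by (simp add: j[OF f] flip: op_adj_right)
        qed
      qed
      then show "j f \<in> M \<and> norm (j f) \<le> R"
        using j(2)[OF f] by blast
    qed
    show "{z \<in> M. norm z \<le> R} \<subseteq> j ` S"
    proof clarify
      fix z
      assume z: "z \<in> M" "norm z \<le> R"
      define f where "f = (\<lambda>(x, y). cinner (blinfun_apply z x) y)"
      have zb: "z \<in> bounded_ops"
        using von_neumann_bounded[OF M z(1)] .
      have "cmod (cinner (z x) y) \<le> R * norm x * norm y" for x y
      proof -
        have "cmod (cinner (z x) y) \<le> norm (z x) * norm y"
          by (rule norm_cinner_le)
        also have "\<dots> \<le> R * norm x * norm y"
          using z(2) by (intro mult_right_mono order_trans[OF norm_blinfun]) auto
        finally show ?thesis .
      qed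
      then have "f \<in> D"
        by (auto simp: D_def f_def)
      moreover have "cinner (z (a x)) y = cinner (z x) (op_adj a y)" if "a \<in> commutant M" for a x y
        using von_neumann_commute[OF z(1) that] op_adj_right[OF commutantD(1)[OF that]]
        by (metis blinfun_apply_blinfun_compose)
      then have "f \<in> L"
        using bounded_ops_scaleC[OF zb]
        by (auto simp: L_def f_def cinner_linear blinfun.bilinear_simps)
      ultimately have f: "f \<in> S"
        by (simp add: S_def)
      have "z = j f"
        by (rule blinfun_eqI, rule cinner_eqI, unfold j(3)[OF f]) (simp add: f_def)
      then show "z \<in> j ` S"
        using f by blast
    qed
  qed
  ultimately show ?thesis
    by simp
qed

text \<open>Finitely many sublevel sets at levels h w, with w in K, share the point w of least
  value; compactness then gives a point of K in all of them.\<close>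

lemma lower_semicontinuous_attains_inf:
  fixes h :: "'a \<Rightarrow> real"
  assumes K: "compactin X K" "K \<noteq> {}" and h: "\<And>t. closedin X {z \<in> topspace X. h z \<le> t}"
  obtains z0 where "z0 \<in> K" "\<And>z. z \<in> K \<Longrightarrow> h z0 \<le> h z"
proof -
  define \<U> where "\<U> = (\<lambda>w. {z \<in> topspace X. h z \<le> h w}) ` K"
  have sub: "K \<subseteq> topspace X"
    using K(1) by (rule compactin_subset_topspace)
  have "K \<inter> \<Inter>\<F> \<noteq> {}" if fin: "finite \<F>" and F: "\<F> \<subseteq> \<U>" for \<F>
  proof -
    obtain W where W: "W \<subseteq> K" "finite W" "\<F> = (\<lambda>w. {z \<in> topspace X. h z \<le> h w}) ` W"
      using finite_subset_image[OF fin F[unfolded \<U>_def]] by blast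
    show ?thesis
    proof (cases "W = {}")
      case False
      have "arg_min_on h W \<in> W" "\<And>w. w \<in> W \<Longrightarrow> h (arg_min_on h W) \<le> h w"
        using arg_min_if_finite[OF W(2) False] arg_min_least[OF W(2) False] by blast+
      then have "arg_min_on h W \<in> K \<inter> \<Inter>\<F>"
        using W sub by auto
      then show ?thesis
        by blast
    qed (use K W in auto)
  qed
  then have "K \<inter> \<Inter>\<U> \<noteq> {}"
    using K(1) h unfolding compactin_fip by (auto simp: \<U>_def)
  then show ?thesis
    using that by (auto simp: \<U>_def)
qed

section \<open>Invariant normal functionals\<close>

context tracial_algebra
begin

text \<open>The square of the 2-norm, the Hilbert space norm that the trace defines on M.\<close>

definition sq :: "'h op \<Rightarrow> real"
  where "sq z = Re (\<tau> (op_adj z o\<^sub>L z))"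

lemma sq_nonneg: "z \<in> M \<Longrightarrow> 0 \<le> sq z"
  using trace_adj_self by (simp add: sq_def nonneg_Reals_iff)

lemma sq_eq_0: "z \<in> M \<Longrightarrow> sq z = 0 \<Longrightarrow> z = 0"
  using trace_adj_self trace_adj_self_eq_0 by (simp add: sq_def nonneg_Reals_iff complex_eq_iff)

lemma trace_expand:
  assumes "x \<in> M" "y \<in> M"
  shows "sq (x + y) = sq x + sq y + (Re (\<tau> (op_adj x o\<^sub>L y)) + Re (\<tau> (op_adj y o\<^sub>L x)))"
    and "sq (x - y) = sq x + sq y - (Re (\<tau> (op_adj x o\<^sub>L y)) + Re (\<tau> (op_adj y o\<^sub>L x)))"
  using assms by (simp_all add: sq_def op_adj_simps op_compose_simps trace_add trace_diff)

lemma sq_parallelogram: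
  assumes "x \<in> M" "y \<in> M"
  shows "sq (x + y) + sq (x - y) = 2 * sq x + 2 * sq y"
  using trace_expand[OF assms] by simp

text \<open>Hermitian symmetry of \<tau> is not among the clauses of \<open>tracial_state\<close>;
  here it comes from the trace being real on the square of x + \<i>y.\<close>

lemma Re_trace_adj:
  assumes x: "x \<in> M" and y: "y \<in> M"
  shows "Re (\<tau> (op_adj x o\<^sub>L y)) = Re (\<tau> (op_adj y o\<^sub>L x))"
proof -
  define z where "z = op_scaleC \<i> y"
  have z: "z \<in> M"
    using y by (simp add: z_def)
  have adj: "op_adj z = op_scaleC (- \<i>) (op_adj y)"
    using y by (simp add: z_def op_adj_simps)
  have "op_adj (x + z) o\<^sub>L (x + z) = (op_adj x o\<^sub>L x) + (op_adj z o\<^sub>L z)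
      + op_scaleC \<i> ((op_adj x o\<^sub>L y) - (op_adj y o\<^sub>L x))"
    using x y z by (simp add: op_adj_simps op_compose_simps adj)
      (simp add: z_def op_scaleC_compose op_scaleC_minus; rule blinfun_eqI; simp add: scaleC_diff_right)
  then have "\<tau> (op_adj (x + z) o\<^sub>L (x + z)) = \<tau> (op_adj x o\<^sub>L x) + \<tau> (op_adj z o\<^sub>L z)
      + \<i> * (\<tau> (op_adj x o\<^sub>L y) - \<tau> (op_adj y o\<^sub>L x))"
    using x y z by (simp add: trace_add trace_diff trace_scaleC)
  then show ?thesis
    using trace_adj_self[of "x + z"] trace_adj_self[OF x] trace_adj_self[OF z] x z
    by (simp add: nonneg_Reals_iff)
qed

text \<open>Lower semicontinuity of the 2-norm: \<open>sq z\<close> is the supremum over y of the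
  continuous functions 2 Re \<tau>(\<open>op_adj y o\<^sub>L z\<close>) - \<open>sq y\<close>,
  attained at y = z because \<open>sq (z - y)\<close> is nonnegative.\<close>

lemma closedin_sq_le: "closedin (subtopology ultraweak_topology M) {z \<in> M. sq z \<le> t}"
proof -
  let ?X = "subtopology ultraweak_topology M"
  have "sq z \<le> t \<longleftrightarrow> (\<forall>y\<in>M. 2 * Re (\<tau> (op_adj y o\<^sub>L z)) - sq y \<le> t)" if z: "z \<in> M" for z
  proof
    assume le: "sq z \<le> t"
    show "\<forall>y\<in>M. 2 * Re (\<tau> (op_adj y o\<^sub>L z)) - sq y \<le> t"
    proof
      fix y
      assume y: "y \<in> M"
      show "2 * Re (\<tau> (op_adj y o\<^sub>L z)) - sq y \<le> t"
        using sq_nonneg[of "z - y"] trace_expand(2)[OF z y] Re_trace_adj[OF z y] y z le by simp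
    qed
  next
    assume "\<forall>y\<in>M. 2 * Re (\<tau> (op_adj y o\<^sub>L z)) - sq y \<le> t"
    then have "2 * Re (\<tau> (op_adj z o\<^sub>L z)) - sq z \<le> t"
      using z by blast
    then show "sq z \<le> t"
      by (simp add: sq_def)
  qed
  then have "{z \<in> M. sq z \<le> t} = M \<inter> (\<Inter>y\<in>M. {z. 2 * Re (\<tau> (op_adj y o\<^sub>L z)) - sq y \<le> t})"
    by blast
  also have "\<dots> = (\<Inter>y\<in>M. {z \<in> topspace ?X. \<tau> (op_adj y o\<^sub>L z) \<in> {w. 2 * Re w - sq y \<le> t}})"
    using mem(1) by (simp only: topspace_subtopology topspace_ultraweak) blast
  finally have eq: "{z \<in> M. sq z \<le> t} = \<dots>" .
  have "closedin ?X {z \<in> topspace ?X. \<tau> (op_adj y o\<^sub>L z) \<in> {w. 2 * Re w - sq y \<le> t}}"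
    if y: "y \<in> M" for y
  proof (rule closedin_continuous_map_preimage)
    have "continuous_map ?X ultraweak_topology (\<lambda>z. op_adj y o\<^sub>L z)"
      using y by (intro continuous_map_from_subtopology continuous_map_compose_left) simp
    then have "continuous_map ?X ?X (\<lambda>z. op_adj y o\<^sub>L z)"
      using y by (simp add: continuous_map_in_subtopology Pi_iff image_subset_iff)
    from continuous_map_compose[OF this trace_continuous]
    show "continuous_map ?X euclidean (\<lambda>z. \<tau> (op_adj y o\<^sub>L z))"
      by (simp add: o_def)
    show "closedin euclidean {w. 2 * Re w - sq y \<le> t}"
      by (auto intro!: closed_Collect_le continuous_intros)
  qed
  moreover have "M \<noteq> {}"
    using mem(1) by blast
  ultimately show ?thesis
    unfolding eq by (intro closedin_Inter) auto
qed

lemma invariant_functional_eq_0: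
  assumes N: "von_neumann_algebra N" and irreducible: "commutant N \<inter> M \<subseteq> scalar_ops" and NM: "N \<subseteq> M"
    and cont: "continuous_map (subtopology ultraweak_topology M) euclidean \<omega>"
    and add: "\<And>x y. x \<in> M \<Longrightarrow> y \<in> M \<Longrightarrow> \<omega> (x + y) = \<omega> x + \<omega> y"
    and scale: "\<And>c x. x \<in> M \<Longrightarrow> \<omega> (op_scaleC c x) = c * \<omega> x"
    and unit: "\<omega> id_blinfun = 0"
    and inv: "\<And>u x. u \<in> N \<Longrightarrow> op_adj u o\<^sub>L u = id_blinfun \<Longrightarrow> x \<in> M \<Longrightarrow> \<omega> (u o\<^sub>L x o\<^sub>L op_adj u) = \<omega> x"
    and x: "x \<in> M"
  shows "\<omega> x = (0::complex)"
proof -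
  let ?X = "subtopology ultraweak_topology M"
  define K where "K = {z \<in> M. norm z \<le> norm x} \<inter> {z \<in> topspace ?X. \<omega> z \<in> {\<omega> x}}"
  have K_iff: "z \<in> K \<longleftrightarrow> z \<in> M \<and> norm z \<le> norm x \<and> \<omega> z = \<omega> x" for z
    by (auto simp: K_def)
  have comp: "compactin ?X K"
    unfolding K_def
    by (intro compact_Int_closedin closedin_continuous_map_preimage[OF cont])
      (auto simp: compactin_subtopology compactin_ultraweak_ball[OF M])
  have ne: "K \<noteq> {}"
    using x K_iff by blast
  have "closedin ?X {z \<in> topspace ?X. sq z \<le> t}" for t
    using closedin_sq_le by simp
  from lower_semicontinuous_attains_inf[OF comp ne this]
  obtain z where z: "z \<in> K" "\<And>w. w \<in> K \<Longrightarrow> sq z \<le> sq w"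
    by blast
  have zM: "z \<in> M" and zb: "z \<in> bounded_ops"
    using z by (auto simp: K_iff)
  \<comment> \<open>Strict convexity of the 2-norm: the midpoint m is again in K, so its 2-norm is
    not below that of z, and the parallelogram law leaves nothing for w - z.\<close>
  have unique: "w = z" if w: "w \<in> K" "sq w \<le> sq z" for w
  proof -
    define m where "m = (1/2) *\<^sub>R (w + z)"
    have wz: "w \<in> M" "z \<in> M"
      using w z by (auto simp: K_iff)
    have "norm m \<le> norm x"
      using norm_triangle_ineq[of w z] w z by (simp add: m_def K_iff)
    moreover have "\<omega> m = \<omega> x"
      using scale[of "w + z" "of_real (1/2)"] add[OF wz] w z wz
      by (simp add: m_def K_iff flip: op_scaleC_of_real)
    ultimately have "m \<in> K"
      using wz by (simp add: m_def K_iff)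
    have half: "sq ((1/2) *\<^sub>R v) = sq v / 4" if "v \<in> M" for v
      using that by (simp add: sq_def op_adj_simps op_compose_simps trace_scaleR)
    have "sq z \<le> sq (w + z) / 4"
      using z(2)[OF \<open>m \<in> K\<close>] wz half by (simp add: m_def)
    then have "sq (w - z) \<le> 0"
      using sq_parallelogram[OF wz] w by simp
    then have "w - z = 0"
      using wz sq_nonneg[of "w - z"] by (intro sq_eq_0) auto
    then show ?thesis
      by simp
  qed
  have "z o\<^sub>L u = u o\<^sub>L z" if u: "u \<in> N" "op_adj u o\<^sub>L u = id_blinfun" for u
  proof -
    have uM: "u \<in> M"
      using u NM by blast
    have norm_u: "norm u \<le> 1"
    proof (rule norm_blinfun_bound)
      fix v
      have "(norm (u v))\<^sup>2 = (norm v)\<^sup>2"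
        using op_adj_inner[of u "u v" v] uM arg_cong[OF u(2), of "\<lambda>T. T v"]
        by (simp add: power2_norm_eq_inner)
      then show "norm (u v) \<le> 1 * norm v"
        by (simp add: power2_eq_iff_nonneg)
    qed simp
    \<comment> \<open>The conjugate stays in K because u is contractive and \<omega> is invariant;
      the trace property together with \<open>op_adj u o\<^sub>L u = id_blinfun\<close> preserves
      \<open>sq\<close>.\<close>
    let ?w = "u o\<^sub>L z o\<^sub>L op_adj u"
    have "norm ?w \<le> 1 * norm z * 1"
      using norm_u op_adj_works(3)[of u] uM by (intro norm_blinfun_compose_le) auto
    then have "?w \<in> K"
      using z(1) inv[OF u zM] uM by (simp add: K_iff)
    moreover have "sq ?w = sq z"
    proof -
      have "op_adj ?w o\<^sub>L ?w = u o\<^sub>L (op_adj z o\<^sub>L (op_adj u o\<^sub>L u) o\<^sub>L z o\<^sub>L op_adj u)"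
        using uM zM by (simp add: op_adj_simps op_compose_simps(9))
      also have "\<dots> = u o\<^sub>L (op_adj z o\<^sub>L z o\<^sub>L op_adj u)"
        by (simp add: u op_compose_simps)
      finally have "\<tau> (op_adj ?w o\<^sub>L ?w) = \<tau> (op_adj z o\<^sub>L z o\<^sub>L op_adj u o\<^sub>L u)"
        using uM zM by (simp add: trace_commute[of u])
      also have "op_adj z o\<^sub>L z o\<^sub>L op_adj u o\<^sub>L u = op_adj z o\<^sub>L z"
        by (simp add: u op_compose_simps)
      finally show ?thesis
        by (simp add: sq_def)
    qed
    ultimately have "?w = z"
      using unique by simp
    then have "z o\<^sub>L u = u o\<^sub>L z o\<^sub>L (op_adj u o\<^sub>L u)"
      by (metis op_compose_simps(9))
    then show ?thesis
      by (simp add: u op_compose_simps)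
  qed
  then have "z \<in> commutant N"
    using commute_all_isometries[OF von_neumann_star_algebra[OF N] closed_von_neumann[OF N] zb] by blast
  then obtain c where "z = op_scaleC c id_blinfun"
    using irreducible zM by (auto simp: scalar_ops_def)
  then show ?thesis
    using z(1) scale[of id_blinfun c] unit by (simp add: K_iff)
qed

end

section \<open>Bimodule channels\<close>

lemma op_pos_adj_self: "a \<in> bounded_ops \<Longrightarrow> op_pos (op_adj a o\<^sub>L a)"
  by (simp add: op_pos_def op_adj_works cinner_self flip: of_real_power)

lemma matrix_pos_1: "matrix_pos 1 (\<lambda>_ _. d) \<longleftrightarrow> op_pos d"
  unfolding matrix_pos_def op_pos_def
  by (auto dest: spec[of _ "\<lambda>_. _"])

locale irreducible_channel = tracial_algebra +
  fixes N :: "'a op set" and \<Phi> :: "'a op \<Rightarrow> 'a op"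
  assumes channel: "bimodule_channel M N \<Phi>"
    and irreducible: "commutant N \<inter> M = scalar_ops"
begin

lemma
  shows N: "von_neumann_algebra N" and N_sub: "N \<subseteq> M"
    and channel_mem [simp]: "x \<in> M \<Longrightarrow> \<Phi> x \<in> M"
    and channel_add: "x \<in> M \<Longrightarrow> y \<in> M \<Longrightarrow> \<Phi> (x + y) = \<Phi> x + \<Phi> y"
    and channel_scaleC: "x \<in> M \<Longrightarrow> \<Phi> (op_scaleC c x) = op_scaleC c (\<Phi> x)"
    and channel_id: "\<Phi> id_blinfun = id_blinfun"
    and channel_bimodule: "x \<in> M \<Longrightarrow> y \<in> N \<Longrightarrow> z \<in> N \<Longrightarrow> \<Phi> (y o\<^sub>L x o\<^sub>L z) = y o\<^sub>L \<Phi> x o\<^sub>L z"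
    and channel_positive: "completely_positive_on M \<Phi>"
    and channel_normal: "continuous_map (subtopology ultraweak_topology M)
      (subtopology ultraweak_topology M) \<Phi>"
  using channel by (simp_all add: bimodule_channel_def linear_map_on_def normal_map_on_def)

lemma channel_scaleR: "x \<in> M \<Longrightarrow> \<Phi> (r *\<^sub>R x) = r *\<^sub>R \<Phi> x"
  using channel_scaleC[of x "of_real r"] by (simp add: op_scaleC_of_real)

lemma channel_diff: "x \<in> M \<Longrightarrow> y \<in> M \<Longrightarrow> \<Phi> (x - y) = \<Phi> x - \<Phi> y"
  using channel_add[of "x - y" y] by simp

lemma channel_fixes_N:
  assumes "y \<in> N"
  shows "\<Phi> y = y"
proof -
  have "\<Phi> (y o\<^sub>L id_blinfun o\<^sub>L id_blinfun) = y o\<^sub>L \<Phi> id_blinfun o\<^sub>L id_blinfun"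
    by (intro channel_bimodule assms mem(1) star_algebra_id[OF von_neumann_star_algebra[OF N]])
  then show ?thesis
    by (simp add: channel_id op_compose_simps)
qed

lemma trace_channel:
  assumes x: "x \<in> M"
  shows "\<tau> (\<Phi> x) = \<tau> x"
proof -
  have "\<tau> (\<Phi> x) - \<tau> x = 0"
  proof (rule invariant_functional_eq_0[OF N _ N_sub _ _ _ _ _ x])
    show "commutant N \<inter> M \<subseteq> scalar_ops"
      using irreducible by simp
    show "continuous_map (subtopology ultraweak_topology M) euclidean (\<lambda>x. \<tau> (\<Phi> x) - \<tau> x)"
      using continuous_map_compose[OF channel_normal trace_continuous]
      by (intro continuous_map_diff trace_continuous) (simp add: o_def)
    \<comment> \<open>\<Phi> commutes with conjugation by u because u and its adjoint lie in
      \<open>N\<close>, and \<tau> absorbs the conjugation by cyclicity.\<close>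
    show "\<tau> (\<Phi> (u o\<^sub>L y o\<^sub>L op_adj u)) - \<tau> (u o\<^sub>L y o\<^sub>L op_adj u) = \<tau> (\<Phi> y) - \<tau> y"
      if u: "u \<in> N" "op_adj u o\<^sub>L u = id_blinfun" and y: "y \<in> M" for u y
    proof -
      have uM: "u \<in> M"
        using u N_sub by blast
      have conj: "\<tau> (u o\<^sub>L v o\<^sub>L op_adj u) = \<tau> v" if v: "v \<in> M" for v
      proof -
        have "\<tau> (u o\<^sub>L (v o\<^sub>L op_adj u)) = \<tau> (v o\<^sub>L op_adj u o\<^sub>L u)"
          using uM v by (intro trace_commute) auto
        then show ?thesis
          by (simp add: op_compose_simps u)
      qed
      have "\<Phi> (u o\<^sub>L y o\<^sub>L op_adj u) = u o\<^sub>L \<Phi> y o\<^sub>L op_adj u"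
        using u y star_algebra_adj[OF von_neumann_star_algebra[OF N]] by (intro channel_bimodule)
      then show ?thesis
        using conj y by simp
    qed
  qed (simp_all add: channel_add channel_scaleC channel_id trace_add trace_scaleC algebra_simps)
  then show ?thesis
    by simp
qed

section \<open>Adjoints, the Kadison--Schwarz inequality and the multiplicative domain\<close>

lemma channel_pos:
  assumes "d \<in> M" "op_pos d"
  shows "op_pos (\<Phi> d)"
proof -
  have "matrix_pos 1 (\<lambda>_ _. \<Phi> d)"
    using channel_positive[unfolded completely_positive_on_def, rule_format, of 1 "\<lambda>_ _. d"] assms
    by (simp only: matrix_pos_1) simp
  then show ?thesis
    by (simp only: matrix_pos_1)
qed

text \<open>Complete positivity applied to the positive matrix with rows $(a^*a, a^*)$ and $(a, 1)$.\<close>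

lemma channel_matrix_pos:
  assumes a: "a \<in> M"
  shows "cinner (\<Phi> (op_adj a o\<^sub>L a) v) v + cinner (\<Phi> (op_adj a) w) v
    + cinner (\<Phi> a v) w + cinner w w \<in> \<real>\<^sub>\<ge>\<^sub>0"
proof -
  define x where "x i j = (if i = 0 then if j = 0 then op_adj a o\<^sub>L a else op_adj a
      else if j = 0 then a else id_blinfun)" for i j :: nat
  have "matrix_pos 2 x"
    unfolding matrix_pos_def
  proof
    fix \<xi> :: "nat \<Rightarrow> 'a"
    \<comment> \<open>The matrix is the Gram matrix of the row (a, 1), so its form is a squared
      norm.\<close>
    have "(\<Sum>i<2. \<Sum>j<2. cinner (x i j (\<xi> j)) (\<xi> i)) = cinner (a (\<xi> 0) + \<xi> 1) (a (\<xi> 0) + \<xi> 1)"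
      using a by (simp add: x_def numeral_2_eq_2 lessThan_Suc op_adj_works cinner_linear)
    then show "(\<Sum>i<2. \<Sum>j<2. cinner (x i j (\<xi> j)) (\<xi> i)) \<in> \<real>\<^sub>\<ge>\<^sub>0"
      by (simp add: cinner_self flip: of_real_power)
  qed
  moreover have "\<forall>i<2. \<forall>j<2. x i j \<in> M"
    using a by (simp add: x_def)
  ultimately have "matrix_pos 2 (\<lambda>i j. \<Phi> (x i j))"
    using channel_positive by (auto simp: completely_positive_on_def)
  from this[unfolded matrix_pos_def, THEN spec, of "\<lambda>k. if k = 0 then v else w"]
  show ?thesis
    by (simp add: x_def numeral_2_eq_2 lessThan_Suc channel_id add_ac)
qed

text \<open>The matrix inequality makes its left-hand side real. Both diagonal terms are real, one
  of them by the case w = 0, so the two mixed terms have opposite imaginary parts.\<close>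

lemma channel_adj:
  assumes a: "a \<in> M"
  shows "\<Phi> (op_adj a) = op_adj (\<Phi> a)"
proof -
  define S where "S = \<Phi> (op_adj a) - op_adj (\<Phi> a)"
  have S: "S \<in> M"
    using a by (simp add: S_def)
  have Im: "Im (cinner (S w) v) = 0" for v w
  proof -
    have "Im (cinner (\<Phi> (op_adj a) w) v) + Im (cinner (\<Phi> a v) w) = 0"
      using channel_matrix_pos[OF a, of v w] channel_matrix_pos[OF a, of v 0]
      by (simp add: nonneg_Reals_iff cinner_self blinfun.zero_right)
    moreover have "cinner (op_adj (\<Phi> a) w) v = cnj (cinner (\<Phi> a v) w)"
      using a by (metis op_adj_works(1) cinner_commute bounded channel_mem)
    ultimately show ?thesis
      by (simp add: S_def cinner_diff_left)
  qed
  \<comment> \<open>Replacing w by \<i>w turns the statement on imaginary parts into one on real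
    parts.\<close>
  have "cinner (S w) v = 0" for v w
    using Im[of w v] Im[of "\<i> *\<^sub>C w" v]
    by (simp add: bounded_ops_scaleC[OF bounded[OF S]] cinner_scaleC_left complex_eq_iff)
  then have "S = 0"
    using bounded[OF S] by (intro op_eq_zeroI)
  then show ?thesis
    by (simp add: S_def)
qed

text \<open>The failure of multiplicativity, an operator-valued Hermitian form that is positive by
  Kadison--Schwarz; the multiplicative domain is described by its vanishing.\<close>

definition defect :: "'a op \<Rightarrow> 'a op \<Rightarrow> 'a op"
  where "defect a b = \<Phi> (op_adj a o\<^sub>L b) - (op_adj (\<Phi> a) o\<^sub>L \<Phi> b)"

lemma defect_mem [simp]: "a \<in> M \<Longrightarrow> b \<in> M \<Longrightarrow> defect a b \<in> M"
  by (simp add: defect_def)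

text \<open>The choice w = -\<Phi>(a) v minimises the form of the 2-by-2 matrix for fixed v; the
  minimum is the Schur complement, which is the defect.\<close>

lemma kadison_schwarz:
  assumes a: "a \<in> M"
  shows "op_pos (defect a a)"
  unfolding op_pos_def
proof
  fix v
  have "cinner (defect a a v) v = cinner (\<Phi> (op_adj a o\<^sub>L a) v) v + cinner (\<Phi> (op_adj a) (- \<Phi> a v)) v
    + cinner (\<Phi> a v) (- \<Phi> a v) + cinner (- \<Phi> a v) (- \<Phi> a v)"
    using a by (simp add: defect_def channel_adj cinner_diff_left blinfun.minus_right)
  then show "cinner (defect a a v) v \<in> \<real>\<^sub>\<ge>\<^sub>0"
    using channel_matrix_pos[OF a, of v "- \<Phi> a v"] by simp
qed

lemma defect_adj: "a \<in> M \<Longrightarrow> b \<in> M \<Longrightarrow> op_adj (defect a b) = defect b a"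
  by (simp add: defect_def op_adj_simps flip: channel_adj)

lemma defect_add:
  "a \<in> M \<Longrightarrow> b \<in> M \<Longrightarrow> c \<in> M \<Longrightarrow> defect a (b + c) = defect a b + defect a c"
  "a \<in> M \<Longrightarrow> b \<in> M \<Longrightarrow> c \<in> M \<Longrightarrow> defect (a + b) c = defect a c + defect b c"
  by (simp_all add: defect_def op_adj_simps op_compose_simps channel_add)

lemma defect_scaleC:
  "a \<in> M \<Longrightarrow> b \<in> M \<Longrightarrow> defect a (op_scaleC c b) = op_scaleC c (defect a b)"
  by (simp add: defect_def op_adj_simps op_scaleC_compose channel_scaleC)
    (rule blinfun_eqI; simp add: scaleC_diff_right)

lemma defect_scaleR:
  "a \<in> M \<Longrightarrow> b \<in> M \<Longrightarrow> defect a (r *\<^sub>R b) = r *\<^sub>R defect a b"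
  "a \<in> M \<Longrightarrow> b \<in> M \<Longrightarrow> defect (r *\<^sub>R a) b = r *\<^sub>R defect a b"
  by (simp_all add: defect_def op_adj_simps op_compose_simps channel_scaleR scaleR_diff_right)

text \<open>Cauchy--Schwarz for the positive form at each vector v: along x + t y the constant term
  vanishes, and nonnegativity for all t forces the linear term to vanish.\<close>

lemma defect_eq_0:
  assumes x: "x \<in> M" "defect x x = 0" and y: "y \<in> M"
  shows "defect x y = 0"
proof -
  have inner0: "inner (defect x y v) v = 0" if y: "y \<in> M" for y v
  proof -
    have "(inner (defect x y v) v)\<^sup>2 \<le> 0 * inner (defect y y v) v"
    proof (rule nonneg_quadratic_discriminant)
      fix t :: real
      have "defect (x + t *\<^sub>R y) (x + t *\<^sub>R y)
          = t *\<^sub>R defect x y + t *\<^sub>R defect y x + t\<^sup>2 *\<^sub>R defect y y"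
        using x y by (simp add: defect_add defect_scaleR power2_eq_square scaleR_add_right)
      moreover have "inner (defect y x v) v = inner (defect x y v) v"
        using op_adj_inner[of "defect x y" v v] x y by (simp add: defect_adj inner_commute)
      ultimately show "0 \<le> 0 + 2 * t * inner (defect x y v) v + t\<^sup>2 * inner (defect y y v) v"
        using op_pos_inner[OF kadison_schwarz[of "x + t *\<^sub>R y"], of v] x y
        by (simp add: inner_add_left)
    qed (use y op_pos_inner kadison_schwarz in blast)
    then show ?thesis
      by simp
  qed
  show ?thesis
  proof (rule op_eq_zeroI)
    \<comment> \<open>The real part comes from y and the imaginary part from \<i>y, as the defect is
      complex-linear in its second argument.\<close>
    show "cinner (defect x y v) v = 0" for v
      using inner0[OF y, of v] inner0[of "op_scaleC \<i> y" v] x y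
      by (simp add: defect_scaleC inner_eq_Re_cinner cinner_scaleC_left complex_eq_iff)
  qed (use x y in simp)
qed

section \<open>The algebra of fixed points\<close>

definition fixed :: "'a op set"
  where "fixed = {x \<in> M. \<Phi> x = x}"

lemma fixedD: "x \<in> fixed \<Longrightarrow> x \<in> M" "x \<in> fixed \<Longrightarrow> \<Phi> x = x"
  by (simp_all add: fixed_def)

lemma adj_fixed: "x \<in> fixed \<Longrightarrow> op_adj x \<in> fixed"
  by (simp add: fixed_def channel_adj)

lemma N_sub_fixed: "N \<subseteq> fixed"
  using N_sub channel_fixes_N by (auto simp: fixed_def)

text \<open>The trace of the positive element $\Phi(x^*x) - x^*x$ vanishes.\<close>

lemma defect_fixed:
  assumes x: "x \<in> fixed"
  shows "defect x x = 0"
proof (rule trace_pos_eq_0)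
  have "\<tau> (defect x x) = \<tau> (\<Phi> (op_adj x o\<^sub>L x)) - \<tau> (op_adj x o\<^sub>L x)"
    using fixedD[OF x] by (simp add: defect_def trace_diff)
  then show "\<tau> (defect x x) = 0"
    using fixedD[OF x] by (simp add: trace_channel)
qed (use fixedD[OF x] kadison_schwarz in auto)

text \<open>The vanishing defect of \<open>op_adj x\<close> against y is the multiplicativity of
  \<Phi> on the product of x and y, and \<Phi> fixes x.\<close>

lemma channel_mult_left:
  assumes x: "x \<in> fixed" and y: "y \<in> M"
  shows "\<Phi> (x o\<^sub>L y) = x o\<^sub>L \<Phi> y"
proof -
  have "defect (op_adj x) y = 0"
    using defect_eq_0 defect_fixed adj_fixed[OF x] fixedD(1) y by blast
  then show ?thesis
    using fixedD[OF x] fixedD(2)[OF adj_fixed[OF x]] by (simp add: defect_def op_adj_simps)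
qed

lemma channel_mult_right:
  assumes x: "x \<in> fixed" and y: "y \<in> M"
  shows "\<Phi> (y o\<^sub>L x) = \<Phi> y o\<^sub>L x"
proof -
  have "op_adj (\<Phi> (y o\<^sub>L x)) = \<Phi> (op_adj x o\<^sub>L op_adj y)"
    using fixedD(1)[OF x] y by (simp add: op_adj_simps flip: channel_adj)
  also have "\<dots> = op_adj x o\<^sub>L op_adj (\<Phi> y)"
    using channel_mult_left[OF adj_fixed[OF x]] y by (simp add: channel_adj)
  also have "\<dots> = op_adj (\<Phi> y o\<^sub>L x)"
    using fixedD(1)[OF x] y by (simp add: op_adj_simps)
  finally have "op_adj (op_adj (\<Phi> (y o\<^sub>L x))) = op_adj (op_adj (\<Phi> y o\<^sub>L x))"
    by simp
  then show ?thesis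
    using fixedD(1)[OF x] y by (simp add: op_adj_simps(6))
qed

lemma star_algebra_fixed: "star_algebra fixed"
  unfolding star_algebra_def
proof (intro conjI ballI allI)
  show "x o\<^sub>L y \<in> fixed" if "x \<in> fixed" "y \<in> fixed" for x y
    using that channel_mult_left[OF that(1), of y] by (simp add: fixed_def)
qed (auto simp: channel_id channel_add channel_scaleC adj_fixed, auto simp: fixed_def channel_id channel_add channel_scaleC)

lemma bicommutant_fixed: "commutant (commutant fixed) = fixed"
proof
  show "fixed \<subseteq> commutant (commutant fixed)"
    using fixedD(1) by (auto intro!: commutantI simp: commutantD)
  show "commutant (commutant fixed) \<subseteq> fixed"
  proof
    fix T
    assume T: "T \<in> commutant (commutant fixed)"
    \<comment> \<open>Normality of \<Phi> is continuity on M only, so T must first be placed in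
      M.\<close>
    have "commutant M \<subseteq> commutant fixed"
      using fixedD(1) by (auto simp: commutant_def)
    then have TM: "T \<in> M"
      using T by (intro von_neumann_memI[OF M]) (auto simp: commutant_def)
    have eq: "cinner (\<Phi> T v) w = cinner (T v) w" for v w
    proof (rule ccontr)
      let ?X = "subtopology ultraweak_topology M"
      define \<psi> where "\<psi> x = cinner (blinfun_apply x v) w" for x :: "'a op"
      assume neq: "cinner (\<Phi> T v) w \<noteq> cinner (T v) w"
      \<comment> \<open>A vector functional is brought into the defining form of the topology by
        sequences supported at index 0. Were \<Phi>(T) and T distinguished by it, the set where it
        separates \<Phi>(x) from x would be an open neighbourhood of T, and density would put a
        fixed point there.\<close>
      have "continuous_map ultraweak_topology euclidean
          (\<lambda>x. \<Sum>n. cinner (blinfun_apply x (if n = (0::nat) then v else 0)) (if n = 0 then w else 0))"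
        by (rule continuous_map_ultraweak_functional)
          (auto simp: square_summable_def intro!: summable_finite[of "{0}"] split: if_splits)
      moreover have "(\<Sum>n. cinner (blinfun_apply x (if n = (0::nat) then v else 0)) (if n = 0 then w else 0)) = \<psi> x"
        for x
        by (subst suminf_finite[of "{0}"]) (auto simp: \<psi>_def)
      ultimately have "continuous_map ?X euclidean \<psi>"
        by (simp add: continuous_map_from_subtopology)
      then have "continuous_map ?X euclidean (\<lambda>x. \<psi> (\<Phi> x) - \<psi> x)"
        using continuous_map_compose[OF channel_normal, of euclidean \<psi>]
        by (intro continuous_map_diff) (simp_all add: o_def)
      then have "openin ?X {x \<in> topspace ?X. \<psi> (\<Phi> x) - \<psi> x \<in> - {0}}"
        by (rule openin_continuous_map_preimage) auto
      then obtain W where W: "openin ultraweak_topology W"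
        "{x \<in> topspace ?X. \<psi> (\<Phi> x) - \<psi> x \<in> - {0}} = W \<inter> M"
        by (auto simp: openin_subtopology)
      have "T \<in> W"
        using W(2) TM neq by (auto simp: \<psi>_def)
      then obtain x where x: "x \<in> fixed" "x \<in> W"
        using star_algebra_ultraweakly_dense[OF star_algebra_fixed T W(1)] by blast
      then have "x \<in> {x \<in> topspace ?X. \<psi> (\<Phi> x) - \<psi> x \<in> - {0}}"
        unfolding W(2) using fixedD(1) by blast
      then show False
        using fixedD(2)[OF x(1)] by simp
    qed
    have "\<Phi> T = T"
      by (rule blinfun_eqI, rule cinner_eqI, rule eq)
    then show "T \<in> fixed"
      using TM by (simp add: fixed_def)
  qed
qed

lemma von_neumann_fixed: "von_neumann_algebra fixed"
  using bicommutant_fixed star_algebra_fixed by (auto simp: von_neumann_algebra_def star_algebra_def)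

lemma factor_fixed: "factor fixed"
  unfolding factor_def
proof (intro conjI von_neumann_fixed equalityI)
  have "commutant fixed \<subseteq> commutant N"
    using N_sub_fixed by (auto simp: commutant_def)
  then show "fixed \<inter> commutant fixed \<subseteq> scalar_ops"
    using irreducible fixedD(1) by blast
  show "scalar_ops \<subseteq> fixed \<inter> commutant fixed"
  proof
    fix x :: "'a op"
    assume "x \<in> scalar_ops"
    then obtain c where x: "x = op_scaleC c id_blinfun"
      by (auto simp: scalar_ops_def)
    have "x \<in> commutant fixed"
      using star_algebra_bounded[OF star_algebra_fixed]
      by (auto simp: x op_scaleC_compose op_compose_simps intro!: commutantI)
    then show "x \<in> fixed \<inter> commutant fixed"
      using star_algebra_scaleC[OF star_algebra_fixed star_algebra_id[OF star_algebra_fixed]]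
      by (simp add: x)
  qed
qed

lemma tracial_state_fixed: "tracial_state fixed id_blinfun \<tau>"
  unfolding tracial_state_def
proof (intro conjI)
  show "continuous_map (subtopology ultraweak_topology fixed) euclidean \<tau>"
    using trace_continuous by (rule continuous_map_from_subtopology_mono) (auto simp: fixed_def)
qed (use fixedD(1) in \<open>auto simp: trace_add trace_scaleC trace_id trace_adj_self
    trace_adj_self_eq_0 intro: trace_commute\<close>)

lemma bimodule_channel_fixed: "bimodule_channel M fixed \<Phi>"
proof -
  have "\<Phi> (y o\<^sub>L x o\<^sub>L z) = y o\<^sub>L \<Phi> x o\<^sub>L z" if "x \<in> M" "y \<in> fixed" "z \<in> fixed" for x y z
    using that fixedD(1) by (simp add: channel_mult_left channel_mult_right)
  then show ?thesis
    using channel von_neumann_fixed by (auto simp: bimodule_channel_def fixed_def)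
qed

lemma relatively_irreducible_fixed: "relatively_irreducible M fixed \<Phi>"
  unfolding relatively_irreducible_def
proof (intro ballI impI; elim conjE exE)
  fix p and c :: real
  assume p: "p \<in> M" "projection p" and c: "0 < c" "op_le (\<Phi> p) (c *\<^sub>R p)"
  define q where "q = \<Phi> p"
  have q: "q \<in> M"
    using p by (simp add: q_def)
  have pp: "p o\<^sub>L p = p" "op_adj p = p"
    using p by (auto simp: projection_def)
  then have p_app: "p (p v) = p v" for v
    by (metis blinfun_apply_blinfun_compose)
  have pos: "op_pos p"
    using op_pos_adj_self[of p] p pp by simp
  have q_pos: "op_pos q"
    unfolding q_def by (rule channel_pos[OF p(1) pos])
  \<comment> \<open>On w = (1 - p) v the form of q is at most c times that of p, which is 0;
    positivity of q upgrades the vanishing form to q w = 0.\<close>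
  have qp0: "q (v - p v) = 0" for v
  proof -
    let ?w = "v - p v"
    have "p ?w = 0"
      by (simp add: blinfun.diff_right p_app)
    moreover have "0 \<le> inner ((c *\<^sub>R p - q) ?w) ?w"
      using c by (intro op_pos_inner) (simp add: op_le_def q_def)
    ultimately have "inner (q ?w) ?w \<le> 0"
      by (simp add: inner_diff_left)
    then have "norm q * inner (q ?w) ?w \<le> 0"
      by (simp add: mult_nonneg_nonpos)
    moreover have "(norm (q ?w))\<^sup>2 \<le> norm q * inner (q ?w) ?w"
      using q by (intro op_pos_norm_power2_le q_pos inner_blinfun_le) simp
    ultimately show ?thesis
      by (metis norm_eq_zero order_trans power2_less_eq_zero_iff)
  qed
  have qp: "q (p v) = q v" for v
    using qp0[of v] by (simp add: blinfun.diff_right)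
  \<comment> \<open>With q self-adjoint, q p = q gives q = p q p.\<close>
  have inner_q: "inner (q v) v = inner (q (p v)) (p v)" for v
  proof -
    have "inner (q (p v)) v = inner (p v) (q v)"
      using op_adj_inner[of q "p v" v] op_pos_adj[OF _ q_pos] q by simp
    also have "\<dots> = inner (q (p v)) (p v)"
      by (simp add: qp inner_commute)
    finally show ?thesis
      by (simp add: qp)
  qed
  have inner_p: "inner (p v) v = inner (p v) (p v)" for v
    using op_adj_inner[of p "p v" v] p pp by (simp add: p_app inner_commute)
  have "op_pos (id_blinfun - p)"
    using op_pos_adj_self[of "id_blinfun - p"] p pp
    by (simp add: op_adj_simps op_compose_simps)
  then have le: "op_pos (id_blinfun - q)"
    using channel_pos[of "id_blinfun - p"] p by (simp add: channel_diff channel_id q_def)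
  have "op_pos (p - q)"
  proof (rule op_posI)
    show "op_adj (p - q) = p - q"
      using p q pp op_pos_adj[OF _ q_pos] by (simp add: op_adj_simps)
    fix v
    \<comment> \<open>This is p - q = p (1 - q) p. The constant c has served only to locate the
      support of q; the bound q \<le> 1 comes from unitality and positivity of \<Phi>.\<close>
    have "inner ((p - q) v) v = inner ((id_blinfun - q) (p v)) (p v)"
      using inner_p[of v] inner_q[of v] by (simp add: inner_diff_left)
    then show "0 \<le> inner ((p - q) v) v"
      using op_pos_inner[OF le] by simp
  qed (use p q in simp)
  moreover have "\<tau> (p - q) = 0"
    using p q by (simp add: trace_diff q_def trace_channel)
  ultimately have "p - q = 0"
    using p q by (intro trace_pos_eq_0) auto
  then show "p \<in> fixed"
    using p by (simp add: fixed_def q_def)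
qed

end

theorem mainTheorem4:
  fixes M N P :: "('h::chilbert_space) op set"
    and \<Phi> :: "'h op \<Rightarrow> 'h op"
  assumes "II1_factor M" and "II1_factor N" and "N \<subseteq> M"
    and "commutant N \<inter> M = scalar_ops"
    and "jones_index M N < \<infinity>"
    and "bimodule_channel M N \<Phi>"
    and "P = {x \<in> M. \<Phi> x = x}"
  shows "II1_factor P \<and> N \<subseteq> P \<and> P \<subseteq> M \<and>
    bimodule_channel M P \<Phi> \<and> relatively_irreducible M P \<Phi>"
proof -
  obtain \<tau> where \<tau>: "tracial_state M id_blinfun \<tau>" and M: "von_neumann_algebra M"
    using assms(1) by (auto simp: II1_factor_def factor_def)
  interpret irreducible_channel M \<tau> N \<Phi>
    by unfold_locales (use M \<tau> assms in auto)
  have P: "P = fixed"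
    by (simp add: assms(7) fixed_def)
  \<comment> \<open>Infinite-dimensionality is inherited from \<open>N\<close>, which lies in the
    fixed point algebra.\<close>
  have "\<nexists>B. finite B \<and> fixed \<subseteq> span B"
    using assms(2) N_sub_fixed by (auto simp: II1_factor_def)
  then have "II1_factor P"
    using factor_fixed tracial_state_fixed by (auto simp: P II1_factor_def)
  then show ?thesis
    using N_sub_fixed fixedD(1) bimodule_channel_fixed relatively_irreducible_fixed
    by (auto simp: P)
qed

end
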